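(* Let $P\subseteq\mathbb{P}^{n-1}$ be a full-dimensional polytope, let $1\le k\le n$, and let $V\in P^{[k]}_{\max}$. Then \[\mathcal{S}_P(V)=\{W\in\mathrm{Gr}(k,n)\mid \mathrm{sign}(\mathrm{C}_P^k|_{\mathcal{F}(V)}(V))\equiv \mathrm{sign}(\mathrm{C}_P^k|_{\mathcal{F}(V)}(W))\}.\]
   Context: Work over $\mathbb{R}$. $\mathrm{Gr}(k,n)$ is the Grassmannian of $k$-dimensional linear subspaces of $\mathbb{R}^n$; a subspace is identified with its image in $\mathbb{P}^{n-1}$. A polytope $P\subseteq\mathbb{P}^{n-1}$ is the image in $\mathbb{P}^{n-1}$ of a cone $\{\sum c_iv_i: c_i\ge0\}$ over finitely many $v_i\in\mathbb{R}^n$ (the projectivization of the cone over a polytope in an affine hyperplane not through the origin); faces and dimensions are those of that polytope. $P^{[k]}=\{V\in\mathrm{Gr}(k,n)\mid V\cap P\neq\emptyset\}$, and $P^{[k]}_{\max}=\{V\in P^{[k]}\mid V\cap G=\emptyset$ for every face $G$ of $P$ with $\dim G<n-k\}$. For $V\in P^{[k]}_{\max}$, the stabbing chamber is $\mathcal{S}_P(V)=\{W\in\mathrm{Gr}(k,n)\mid$ for every $(n-k)$-dimensional face $F$ of $P$: $W\cap\mathrm{relint}(F)\ne\emptyset \iff V\cap\mathrm{relint}(F)\neq\emptyset\}$, and $\mathcal{F}_P(V)$ is the set of $(n-k)$-dimensional faces $F$ of $P$ with $V\cap\mathrm{relint}(F)\ne\emptyset$. Chow forms: for $V\in\mathrm{Gr}(k,n)$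 and $I\in\binom{[n]}{n-k}$ let $p_I(V)$ be the maximal minor on columns $I$ of an $(n-k)\times n$ matrix with kernel $V$; fix an ordering $G_1,\ldots,G_f$ of the $(n-k-1)$-dimensional faces of $P$, for each $G_i$ choose $n-k$ linearly independent vertices (vectors in $\mathbb{R}^n$) of $G_i$ forming the rows of an $(n-k)\times n$ matrix $M^i$, and set $C_{G_i}(V)=\sum_{I} q_I(M^i)p_I(V)$ with $q_I(M^i)$ the maximal minor of $M^i$ on columns $I$. $\mathrm{C}_P^k=(C_{G_1},\ldots,C_{G_f})$, and $\mathrm{C}_P^k|_{\mathcal{F}(V)}$ is the subvector consisting of the $C_G$ with $G$ a facet of some $F\in\mathcal{F}_P(V)$. These vectors are defined up to a common nonzero scalar. For a real vector $x$, $\mathrm{sign}(x)\in\{+,0,-\}^N$ is its coordinatewise sign; for sign vectors, $\alpha\equiv\beta$ means $\alpha=\beta$ or $\alpha=-\beta$. *)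

theory Defs
  imports "HOL-Analysis.Analysis" "HOL-Combinatorics.Permutations"
begin

text \<open>Points of P^{n-1} are represented by nonzero vectors of real^'n (n = CARD('n)).
  A polytope P is represented by the finite set S of generators v_i; the cone
  over P is polycone S. Faces of P of dimension d correspond to nonempty faces
  of the cone of affine dimension d+1.\<close>

definition polycone :: "('a::real_vector) set \<Rightarrow> 'a set" where
  "polycone S = {\<Sum>v\<in>S. c v *\<^sub>R v | c. \<forall>v\<in>S. 0 \<le> c v}"

text \<open>Cone over a polytope in an affine hyperplane not through the origin.\<close>
definition is_polytope :: "(real^'n) set \<Rightarrow> bool" where
  "is_polytope S \<longleftrightarrow> finite S \<and> S \<noteq> {} \<and> (\<exists>a. \<forall>v\<in>S. 0 < a \<bullet> v)"

definition Gr :: "nat \<Rightarrow> (real^'n) set set" where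
  "Gr k = {V. subspace V \<and> dim V = k}"

text \<open>Projective intersection: V meets X in P^{n-1}.\<close>
definition meets :: "(real^'n) set \<Rightarrow> (real^'n) set \<Rightarrow> bool" where
  "meets V X \<longleftrightarrow> (\<exists>x\<in>V. x \<in> X \<and> x \<noteq> 0)"

definition Pk :: "(real^'n) set \<Rightarrow> nat \<Rightarrow> (real^'n) set set" where
  "Pk K k = {V \<in> Gr k. meets V K}"

definition Pmax :: "(real^'n) set \<Rightarrow> nat \<Rightarrow> (real^'n) set set" where
  "Pmax K k = {V \<in> Pk K k. \<forall>G. G face_of K \<and> G \<noteq> {} \<and>
       aff_dim G < int CARD('n) - int k + 1 \<longrightarrow> \<not> meets V G}"

text \<open>(n-k)-dimensional faces of P = cone faces of affine dimension n-k+1.\<close>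
definition top_faces :: "(real^'n) set \<Rightarrow> nat \<Rightarrow> (real^'n) set set" where
  "top_faces K k = {F. F face_of K \<and> aff_dim F = int CARD('n) - int k + 1}"

definition stab_faces :: "(real^'n) set \<Rightarrow> nat \<Rightarrow> (real^'n) set \<Rightarrow> (real^'n) set set" where
  "stab_faces K k V = {F \<in> top_faces K k. meets V (rel_interior F)}"

definition stabbing_chamber :: "(real^'n) set \<Rightarrow> nat \<Rightarrow> (real^'n) set \<Rightarrow> (real^'n) set set" where
  "stabbing_chamber K k V = {W \<in> Gr k. \<forall>F \<in> top_faces K k.
       meets W (rel_interior F) \<longleftrightarrow> meets V (rel_interior F)}"

text \<open>(n-k-1)-dimensional faces of P = cone faces of affine dimension n-k.\<close>
definition low_faces :: "(real^'n) set \<Rightarrow> nat \<Rightarrow> (real^'n) set set" where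
  "low_faces K k = {G. G face_of K \<and> G \<noteq> {} \<and> aff_dim G = int CARD('n) - int k}"

definition chow_support :: "(real^'n) set \<Rightarrow> nat \<Rightarrow> (real^'n) set \<Rightarrow> (real^'n) set set" where
  "chow_support K k V = {G \<in> low_faces K k. \<exists>F \<in> stab_faces K k V. G face_of F}"

text \<open>v is a (vector representative of a) vertex of P lying in G.\<close>
definition is_vertex_in :: "(real^'n) set \<Rightarrow> (real^'n) set \<Rightarrow> real^'n \<Rightarrow> bool" where
  "is_vertex_in K G v \<longleftrightarrow> v \<noteq> 0 \<and> v \<in> G \<and> {c *\<^sub>R v | c. 0 \<le> c} face_of K"

text \<open>M G is the (n-k) x n matrix (rows M G 0, ..., M G (n-k-1)) of linearly
  independent vertices of the face G.\<close>
definition vertex_choice :: "(real^'n) set \<Rightarrow> nat \<Rightarrow> ((real^'n) set \<Rightarrow> nat \<Rightarrow> real^'n) \<Rightarrow> bool" where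
  "vertex_choice K k M \<longleftrightarrow> (\<forall>G \<in> low_faces K k.
      (\<forall>i < CARD('n) - k. is_vertex_in K G (M G i)) \<and>
      inj_on (M G) {..< CARD('n) - k} \<and> independent (M G ` {..< CARD('n) - k}))"

definition kernel_matrix :: "nat \<Rightarrow> (nat \<Rightarrow> real^'n) \<Rightarrow> (real^'n) set \<Rightarrow> bool" where
  "kernel_matrix m A V \<longleftrightarrow> {x. \<forall>i<m. A i \<bullet> x = 0} = V"

definition det_nat :: "nat \<Rightarrow> (nat \<Rightarrow> nat \<Rightarrow> real) \<Rightarrow> real" where
  "det_nat m A = (\<Sum>p | p permutes {..<m}. of_int (sign p) * (\<Prod>i<m. A i (p i)))"

definition minor :: "nat \<Rightarrow> (nat \<Rightarrow> real^('n::{finite,linorder})) \<Rightarrow> 'n set \<Rightarrow> real" where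
  "minor m A I = det_nat m (\<lambda>i j. A i $ (sorted_list_of_set I ! j))"

text \<open>C_G(V) = sum_I q_I(M) p_I(V), where A is a matrix with kernel V.\<close>
definition chow_form :: "nat \<Rightarrow> (nat \<Rightarrow> real^('n::{finite,linorder})) \<Rightarrow> (nat \<Rightarrow> real^('n::{finite,linorder})) \<Rightarrow> real" where
  "chow_form m M A = (\<Sum>I \<in> {I. card I = m}. minor m M I * minor m A I)"

definition sign_equiv :: "'i set \<Rightarrow> ('i \<Rightarrow> real) \<Rightarrow> ('i \<Rightarrow> real) \<Rightarrow> bool" where
  "sign_equiv X x y \<longleftrightarrow> (\<forall>i\<in>X. sgn (x i) = sgn (y i)) \<or> (\<forall>i\<in>X. sgn (x i) = - sgn (y i))"

end

theory Submission
  imports Defs "Jordan_Normal_Form.Determinant"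
begin

text \<open>
  Let \<open>A\<close> have kernel \<open>V\<close>. By Cauchy-Binet, \<open>C\<^sub>G(V)\<close> is the determinant of the pairing of the rows
  of \<open>A\<close> with vertices spanning \<open>G\<close>. For \<open>F\<close> stabbed by \<open>V\<close> in the line of \<open>y\<close> and a facet \<open>G\<close>
  of \<open>F\<close>, it agrees, up to a factor common to all \<open>G\<close>, with a volume form on \<open>span F\<close> evaluated at
  \<open>y\<close> and the vertices of \<open>G\<close>. Any two volume forms on \<open>span F\<close> are proportional, so comparing the
  signs of \<open>C\<^sub>G(V)\<close> and \<open>C\<^sub>G(W)\<close> over the facets \<open>G\<close> of \<open>F\<close> tells whether \<open>W\<close> meets the relative
  interior of \<open>F\<close>. The same argument on \<open>span E\<close>, for a face \<open>E\<close> having two stabbed faces \<open>F\<close> and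
  \<open>F'\<close> as facets, shows that their global signs agree.

  The stabbed faces are the vertices of \<open>V \<inter> P\<close> and those pairs are its edges. The simplex method
  provides both the connectedness needed to propagate the sign, and the fact that a subspace which
  stabs every face in \<open>\<F>(V)\<close> stabs no other face of that dimension: a linear functional on \<open>V \<inter> P\<close>
  that is maximal at a vertex among its neighbours is maximal.
\<close>

no_notation vec_index (infixl "$" 100)
no_notation scalar_prod (infix "\<bullet>" 70)

section \<open>Determinants of pairings\<close>

lemma det_nat_eq_det: "det_nat m A = Determinant.det (Matrix.mat m m (\<lambda>(i, j). A i j))"
  by (simp add: det_nat_def Determinant.det_def lessThan_atLeast0)

text \<open>Coordinate-free counterpart of the Chow form: the points \<open>g\<close> index the
  rows, and the rows of a kernel matrix \<open>A\<close> act on them as functionals.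
  \<open>chow_form_eq_pair_det\<close> identifies the two.\<close>

definition pair_det :: "nat \<Rightarrow> (nat \<Rightarrow> 'a::real_inner) \<Rightarrow> (nat \<Rightarrow> 'a) \<Rightarrow> real" where
  "pair_det m g A = det_nat m (\<lambda>i j. A j \<bullet> g i)"

lemma det_nat_identical_rows:
  assumes "i < m" "j < m" "i \<noteq> j" "A i = A j"
  shows "det_nat m A = 0"
  unfolding det_nat_eq_det
  by (rule det_identical_rows[of _ m i j]) (use assms in \<open>auto intro!: eq_vecI\<close>)

lemma pair_det_upd:
  assumes "i < m"
  shows "pair_det m (g(i := x)) A =
    (\<Sum>p | p permutes {..<m}. of_int (sign p) * (A (p i) \<bullet> x) * (\<Prod>l\<in>{..<m} - {i}. A (p l) \<bullet> g l))"
proof -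
  have "(\<Prod>l<m. A (p l) \<bullet> (g(i := x)) l) = (A (p i) \<bullet> x) * (\<Prod>l\<in>{..<m} - {i}. A (p l) \<bullet> g l)" for p
    using assms by (subst prod.remove[of _ i]) auto
  then show ?thesis
    by (simp add: pair_det_def det_nat_def mult.assoc)
qed

lemma linear_pair_det_upd:
  assumes "i < m"
  shows "linear (\<lambda>x. pair_det m (g(i := x)) A)"
  by (rule linearI)
    (simp_all add: pair_det_upd[OF assms] inner_add_right ring_distribs sum.distrib sum_distrib_left mult_ac)

text \<open>As a function of its \<open>i\<close>-th point the determinant is linear and vanishes at
  each of the other points, hence on their span.\<close>

lemma pair_det_replace:
  assumes i: "i < m" and z: "z - s *\<^sub>R g i \<in> span (g ` ({..<m} - {i}))"
  shows "pair_det m (g(i := z)) A = s * pair_det m g A"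
proof -
  let ?f = "\<lambda>x. pair_det m (g(i := x)) A"
  have lin: "linear ?f" using i by (rule linear_pair_det_upd)
  have "?f y = 0" if "y \<in> g ` ({..<m} - {i})" for y
  proof -
    from that obtain j where "j < m" "j \<noteq> i" "y = g j" by auto
    then show ?thesis
      unfolding pair_det_def using i by (intro det_nat_identical_rows[of i m j]) auto
  qed
  then have "?f (z - s *\<^sub>R g i) = 0"
    using linear_eq_0_on_span[OF lin _ z] by blast
  then show ?thesis
    by (simp add: linear_diff[OF lin] linear_cmul[OF lin])
qed

lemma pair_det_comb:
  assumes "\<And>i. i < m \<Longrightarrow> y i = (\<Sum>l<m. c i l *\<^sub>R e l)"
  shows "pair_det m y C = det_nat m c * pair_det m e C"
proof -
  have "Matrix.mat m m (\<lambda>(i, j). C j \<bullet> y i)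
      = Matrix.mat m m (\<lambda>(i, j). c i j) * Matrix.mat m m (\<lambda>(i, j). C j \<bullet> e i)"
    by (rule eq_matI) (simp_all add: assms scalar_prod_def inner_sum_right lessThan_atLeast0)
  then show ?thesis
    by (simp add: pair_det_def det_nat_eq_det det_mult[of _ m])
qed

lemma span_image_lessThan:
  assumes "x \<in> span (e ` {..<m::nat})"
  shows "\<exists>c. x = (\<Sum>l<m. c l *\<^sub>R e l)"
  using assms
proof (induction rule: span_induct_alt)
  case base
  show ?case by (rule exI[of _ "\<lambda>_. 0"]) simp
next
  case (step c x y)
  then obtain j d where j: "j < m" "x = e j" "y = (\<Sum>l<m. d l *\<^sub>R e l)" by auto
  have "(\<Sum>l<m. (d(j := d j + c)) l *\<^sub>R e l) = (\<Sum>l<m. d l *\<^sub>R e l + (if l = j then c *\<^sub>R e l else 0))"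
    by (rule sum.cong) (auto simp: scaleR_add_left)
  also have "\<dots> = c *\<^sub>R x + y"
    using j by (simp add: sum.distrib)
  finally show ?case by metis
qed

text \<open>Proportionality of volume forms on \<open>X\<close>: over a common spanning family, each
  determinant is a coefficient determinant, depending on the points alone, times a factor depending
  on the functionals alone. Both sides are the product of the same four factors.\<close>

lemma pair_det_exchange:
  fixes X :: "'a::euclidean_space set"
  assumes X: "subspace X" "dim X \<le> m"
    and Y: "\<And>i. i < m \<Longrightarrow> Y i \<in> X" and Z: "\<And>i. i < m \<Longrightarrow> Z i \<in> X"
  shows "pair_det m Y C * pair_det m Z D = pair_det m Z C * pair_det m Y D"
proof -
  obtain B where B: "B \<subseteq> X" "independent B" "X \<subseteq> span B" "card B = dim X"
    using basis_exists by blast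
  have "finite B" using B(2) by (rule independent_imp_finite)
  obtain b where "bij_betw b {0..<card B} B"
    using ex_bij_betw_nat_finite[OF \<open>finite B\<close>] by blast
  then have b: "b ` {0..<card B} = B" by (rule bij_betw_imp_surj_on)
  \<comment> \<open>\<open>b\<close> enumerates \<open>B\<close> below \<open>card B\<close>; its
    values from there up to \<open>m\<close> are arbitrary, as only a spanning family of length
    \<open>m\<close> is wanted.\<close>
  have "B \<subseteq> b ` {..<m}" using b B(4) X(2) by auto
  then have "X \<subseteq> span (b ` {..<m})" using B(3) span_mono by blast
  then have "\<exists>c. x = (\<Sum>l<m. c l *\<^sub>R b l)" if "x \<in> X" for x
    using that span_image_lessThan by blast
  then obtain c where c: "\<And>x. x \<in> X \<Longrightarrow> x = (\<Sum>l<m. c x l *\<^sub>R b l)" by metis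
  have "pair_det m Y' C' = det_nat m (\<lambda>i. c (Y' i)) * pair_det m b C'"
    if "\<And>i. i < m \<Longrightarrow> Y' i \<in> X" for Y' C'
    by (rule pair_det_comb) (simp add: c[OF that, symmetric])
  with Y Z show ?thesis by simp
qed

text \<open>The functionals \<open>A\<close> kill \<open>y\<close>, so the row of \<open>y\<close>
  is \<open>N \<bullet> y\<close> followed by zeros. Such bordering turns a determinant of order
  \<open>m\<close> into a volume form of order \<open>m + 1\<close> with \<open>y\<close> among its
  arguments.\<close>

lemma pair_det_Suc:
  assumes "\<And>j. j < m \<Longrightarrow> A j \<bullet> y = 0"
  shows "pair_det (Suc m) (case_nat y g) (case_nat N A) = (N \<bullet> y) * pair_det m g A"
proof -
  let ?N = "case_nat N A" and ?g = "case_nat y g"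
  have "Matrix.mat (Suc m) (Suc m) (\<lambda>(i, j). ?N j \<bullet> ?g i)
      = four_block_mat (Matrix.mat 1 1 (\<lambda>_. N \<bullet> y)) (0\<^sub>m 1 m)
          (Matrix.mat m 1 (\<lambda>(i, _). N \<bullet> g i)) (Matrix.mat m m (\<lambda>(i, j). A j \<bullet> g i))"
    by (rule eq_matI) (auto simp: assms split: nat.split)
  then show ?thesis
    by (simp add: pair_det_def det_nat_eq_det det_four_block_mat_upper_right_zero[of _ 1 _ m] det_single)
qed

text \<open>If the determinant were zero, a kernel vector would give the coefficients of a nonzero
  point in the span of \<open>g\<close> that all functionals kill.\<close>

lemma pair_det_nonzero:
  assumes inj: "inj_on g {..<m}" and indep: "independent (g ` {..<m})"
    and ker: "\<And>x. x \<in> span (g ` {..<m}) \<Longrightarrow> (\<And>j. j < m \<Longrightarrow> A j \<bullet> x = 0) \<Longrightarrow> x = 0"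
  shows "pair_det m g A \<noteq> 0"
proof
  assume 0: "pair_det m g A = 0"
  \<comment> \<open>Transposed, so that a kernel vector lists coefficients of the points
    \<open>g\<close> and not of the functionals.\<close>
  let ?M = "Matrix.mat m m (\<lambda>(i, j). A i \<bullet> g j)"
  have "?M = transpose_mat (Matrix.mat m m (\<lambda>(i, j). A j \<bullet> g i))" by (rule eq_matI) auto
  then have "Determinant.det ?M = 0"
    using 0 by (simp add: pair_det_def det_nat_eq_det det_transpose[of _ m])
  then obtain v where v: "v \<in> carrier_vec m" "v \<noteq> 0\<^sub>v m" "?M *\<^sub>v v = 0\<^sub>v m"
    using det_0_iff_vec_prod_zero[of ?M m] by auto
  define x where "x = (\<Sum>i<m. vec_index v i *\<^sub>R g i)"
  have "A j \<bullet> x = 0" if "j < m" for j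
  proof -
    have "vec_index (?M *\<^sub>v v) j = 0" using that v(3) by simp
    then show ?thesis
      using that v(1)
      by (simp add: x_def inner_sum_right scalar_prod_def lessThan_atLeast0 mult.commute)
  qed
  moreover have "x \<in> span (g ` {..<m})"
    unfolding x_def by (intro span_sum span_scale span_base) auto
  ultimately have "x = 0" by (rule ker[rotated])
  then have "(\<Sum>u\<in>g ` {..<m}. vec_index v (the_inv_into {..<m} g u) *\<^sub>R u) = 0"
    unfolding x_def using inj by (simp add: sum.reindex the_inv_into_f_f)
  then have "vec_index v i = 0" if "i < m" for i
    using independentD[OF indep _ subset_refl, of "\<lambda>u. vec_index v (the_inv_into {..<m} g u)" "g i"]
      that inj by (simp add: the_inv_into_f_f)
  with v(1,2) show False by (auto intro!: eq_vecI)
qed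

text \<open>Putting \<open>x\<close> in place of a point \<open>g i\<close> that occurs in it scales
  the determinant by a nonzero coefficient and produces a zero row.\<close>

lemma pair_det_eq_0:
  assumes "x \<in> span (g ` {..<m})" "x \<noteq> 0" "\<And>j. j < m \<Longrightarrow> A j \<bullet> x = 0"
  shows "pair_det m g A = 0"
proof -
  obtain c where c: "x = (\<Sum>l<m. c l *\<^sub>R g l)"
    using span_image_lessThan[OF assms(1)] by blast
  then obtain i where i: "i < m" "c i \<noteq> 0"
    using assms(2) sum.neutral[of "{..<m}" "\<lambda>l. c l *\<^sub>R g l"] by force
  have "x - c i *\<^sub>R g i = (\<Sum>l\<in>{..<m} - {i}. c l *\<^sub>R g l)"
    using i(1) unfolding c by (subst sum.remove[of _ i]) auto
  also have "\<dots> \<in> span (g ` ({..<m} - {i}))"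
    by (intro span_sum span_scale span_base) auto
  finally have "pair_det m (g(i := x)) A = c i * pair_det m g A"
    by (rule pair_det_replace[OF i(1)])
  moreover have "A (p i) \<bullet> x = 0" if "p permutes {..<m}" for p
    using assms(3)[of "p i"] permutes_in_image[OF that, of i] i(1) by simp
  then have "pair_det m (g(i := x)) A = 0"
    by (simp add: pair_det_upd[OF i(1)])
  ultimately show ?thesis using i(2) by simp
qed

section \<open>Bordered determinants and the comparison of two facets\<close>

lemma pair_det_replace_first:
  assumes "z - s *\<^sub>R y \<in> span (g ` {..<m})"
  shows "pair_det (Suc m) (case_nat z g) A = s * pair_det (Suc m) (case_nat y g) A"
proof -
  have "(case_nat y g)(0 := z) = case_nat z g" by (auto split: nat.split)
  moreover have "{..<Suc m} - {0} = Suc ` {..<m}"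
    by (auto simp: lessThan_Suc_eq_insert_0)
  then have "case_nat y g ` ({..<Suc m} - {0}) = g ` {..<m}"
    by (simp add: image_image)
  ultimately show ?thesis
    using pair_det_replace[of 0 "Suc m" z s "case_nat y g" A] assms by simp
qed

lemma pair_det_replace_second:
  assumes "z - s *\<^sub>R y \<in> span (insert x (g ` {..<m}))"
  shows "pair_det (Suc (Suc m)) (case_nat x (case_nat z g)) A
    = s * pair_det (Suc (Suc m)) (case_nat x (case_nat y g)) A"
proof -
  let ?g = "case_nat x (case_nat y g)"
  have "?g(Suc 0 := z) = case_nat x (case_nat z g)" by (auto split: nat.split)
  moreover have "{..<Suc (Suc m)} - {Suc 0} = insert 0 ((\<lambda>i. Suc (Suc i)) ` {..<m})"
    by (auto simp: lessThan_Suc_eq_insert_0)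
  then have "?g ` ({..<Suc (Suc m)} - {Suc 0}) = insert x (g ` {..<m})"
    by (simp add: image_image)
  ultimately show ?thesis
    using pair_det_replace[of "Suc 0" "Suc (Suc m)" z s ?g A] assms by simp
qed

text \<open>In the application \<open>X\<close> is the span of a face, met by the kernels of
  \<open>A\<close> and \<open>B\<close> in \<open>y\<close> and \<open>z\<close>; \<open>g\<close>
  and \<open>h\<close> span two of its facets, and \<open>s\<close>, \<open>t\<close> are the
  coordinates of \<open>z\<close> along \<open>y\<close> modulo these facets. After bordering, the
  determinants are values of volume forms on \<open>X\<close>, in which \<open>z\<close> can be
  traded for a multiple of \<open>y\<close>.\<close>

lemma pair_det_ratio_facets:
  fixes X :: "'a::euclidean_space set"
  assumes X: "subspace X" "dim X \<le> Suc m"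
    and y: "y \<in> X" "y \<noteq> 0" "\<And>j. j < m \<Longrightarrow> A j \<bullet> y = 0"
    and z: "z \<noteq> 0" "\<And>j. j < m \<Longrightarrow> B j \<bullet> z = 0"
    and g: "\<And>i. i < m \<Longrightarrow> g i \<in> X" "z - s *\<^sub>R y \<in> span (g ` {..<m})"
    and h: "\<And>i. i < m \<Longrightarrow> h i \<in> X" "z - t *\<^sub>R y \<in> span (h ` {..<m})"
  shows "pair_det m g A * pair_det m h B * s = pair_det m h A * pair_det m g B * t"
proof -
  \<comment> \<open>The same \<open>N\<close> borders both determinants, so it must vanish at
    neither \<open>y\<close> nor \<open>z\<close>.\<close>
  obtain N where N: "N \<bullet> y \<noteq> 0" "N \<bullet> z \<noteq> 0"
  proof (cases "y \<bullet> z = 0")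
    case True
    moreover have "z \<bullet> y = 0" using True by (simp add: inner_commute)
    ultimately show ?thesis using y(2) z(1) that[of "y + z"] by (simp add: inner_add_left)
  next
    case False
    then show ?thesis using y(2) that[of y] by simp
  qed
  let ?A = "case_nat N A" and ?B = "case_nat N B"
  let ?D = "\<lambda>x g. pair_det (Suc m) (case_nat x g)"
  have "pair_det m g A * pair_det m h B * s * ((N \<bullet> y) * (N \<bullet> z))
      = s * (?D y g ?A * ?D z h ?B)"
    by (simp add: pair_det_Suc y z)
  also have "\<dots> = s * t * (?D y g ?A * ?D y h ?B)"
    by (simp add: pair_det_replace_first[OF h(2)])
  also have "?D y g ?A * ?D y h ?B = ?D y h ?A * ?D y g ?B"
    by (rule pair_det_exchange[OF X]) (auto simp: y g h split: nat.split)
  also have "s * t * (?D y h ?A * ?D y g ?B) = t * (?D y h ?A * ?D z g ?B)"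
    by (simp add: pair_det_replace_first[OF g(2)])
  also have "\<dots> = pair_det m h A * pair_det m g B * t * ((N \<bullet> y) * (N \<bullet> z))"
    by (simp add: pair_det_Suc y z)
  finally show ?thesis using N by simp
qed

text \<open>In the application \<open>X\<close> is the span of a face \<open>E\<close>;
  \<open>y\<close> and \<open>z\<close> lie in a facet \<open>F\<close> of \<open>E\<close>,
  \<open>y'\<close> and \<open>z'\<close> in another facet \<open>F'\<close>, and \<open>g\<close>,
  \<open>h\<close> span facets of \<open>F\<close> and of \<open>F'\<close>. Bordering by
  \<open>b\<close>, which exposes \<open>F\<close>, and then by the positive functional
  \<open>a\<close> gives volume forms on \<open>X\<close>. The trading factors are positive and drop
  out of the signs.\<close>

lemma pair_det_sgn_adjacent:
  fixes X :: "'a::euclidean_space set"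
  assumes X: "subspace X" "dim X \<le> Suc (Suc m)" and mem: "y \<in> X" "y' \<in> X"
    and A: "\<And>j. j < m \<Longrightarrow> A j \<bullet> y = 0" "\<And>j. j < m \<Longrightarrow> A j \<bullet> y' = 0"
    and B: "\<And>j. j < m \<Longrightarrow> B j \<bullet> z = 0" "\<And>j. j < m \<Longrightarrow> B j \<bullet> z' = 0"
    and b: "b \<bullet> y = 0" "b \<bullet> z = 0" "0 < b \<bullet> y'" "0 < b \<bullet> z'"
    and a: "0 < a \<bullet> y" "0 < a \<bullet> z"
    and g: "\<And>i. i < m \<Longrightarrow> g i \<in> X" "z - s *\<^sub>R y \<in> span (g ` {..<m})"
      "z' - s' *\<^sub>R y' \<in> span (insert y (g ` {..<m}))" "0 < s" "0 < s'"
    and h: "\<And>i. i < m \<Longrightarrow> h i \<in> X" "z' - t' *\<^sub>R y' \<in> span (h ` {..<m})"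
      "z - t *\<^sub>R y \<in> span (insert y' (h ` {..<m}))" "0 < t" "0 < t'"
  shows "sgn (pair_det m g A * pair_det m h B) = sgn (pair_det m h A * pair_det m g B)"
proof -
  let ?A = "case_nat a (case_nat b A)" and ?B = "case_nat a (case_nat b B)"
  let ?D = "\<lambda>x x' g. pair_det (Suc (Suc m)) (case_nat x (case_nat x' g))"
  \<comment> \<open>Since \<open>b\<close> vanishes at \<open>y\<close> and \<open>z\<close>, these
    points are killed by the enlarged families too, and the outer bordering by \<open>a\<close> is
    again triangular.\<close>
  have kill: "case_nat b A j \<bullet> y = 0" "case_nat b B j \<bullet> z = 0" if "j < Suc m" for j
    using that A B b by (auto split: nat.split)
  have DA: "?D y y' f ?A = (a \<bullet> y) * (b \<bullet> y') * pair_det m f A" for f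
    by (simp add: pair_det_Suc kill A)
  have DB: "?D z z' f ?B = (a \<bullet> z) * (b \<bullet> z') * pair_det m f B" for f
    by (simp add: pair_det_Suc kill B)
  have im: "case_nat x f ` {..<Suc m} = insert x (f ` {..<m})" for x :: 'a and f
    by (force simp: image_iff lessThan_Suc_eq_insert_0)
  have "z - s *\<^sub>R y \<in> span (insert z' (g ` {..<m}))"
    using g(2) span_mono[of "g ` {..<m}" "insert z' (g ` {..<m})"] by blast
  then have Dg: "?D z z' g ?B = s * s' * ?D y y' g ?B"
    by (simp add: pair_det_replace_first im pair_det_replace_second[OF g(3)])
  \<comment> \<open>Here \<open>z'\<close> is traded before \<open>z\<close>, because
    \<open>z\<close> is a multiple of \<open>y\<close> only modulo a span containing
    \<open>y'\<close>.\<close>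
  have "z' - t' *\<^sub>R y' \<in> span (insert z (h ` {..<m}))"
    using h(2) span_mono[of "h ` {..<m}" "insert z (h ` {..<m})"] by blast
  then have Dh: "?D z z' h ?B = t * t' * ?D y y' h ?B"
    using h(3) by (simp add: pair_det_replace_first im pair_det_replace_second)
  have "?D y y' g ?A * ?D y y' h ?B = ?D y y' h ?A * ?D y y' g ?B"
    by (rule pair_det_exchange[OF X]) (auto simp: mem g h split: nat.split)
  then have "sgn (?D y y' g ?A * ?D z z' h ?B) = sgn (?D y y' h ?A * ?D z z' g ?B)"
    using g(4,5) h(4,5) by (simp add: Dg Dh sgn_mult mult_ac)
  then show ?thesis
    using a b by (simp add: DA DB sgn_mult)
qed

section \<open>The Cauchy-Binet formula\<close>

lemma det_nat_transpose: "det_nat m (\<lambda>i j. A j i) = det_nat m A"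
proof -
  have "Matrix.mat m m (\<lambda>(i, j). A j i) = transpose_mat (Matrix.mat m m (\<lambda>(i, j). A i j))"
    by (rule eq_matI) auto
  then show ?thesis
    by (simp add: det_nat_eq_det det_transpose[of _ m])
qed

lemma det_nat_permute_rows:
  assumes "p permutes {..<m}"
  shows "det_nat m (\<lambda>i. A (p i)) = of_int (sign p) * det_nat m A"
proof -
  let ?M = "Matrix.mat m m (\<lambda>(i, j). A i j)"
  have "p i < m" if "i < m" for i
    using permutes_in_image[OF assms, of i] that by simp
  then have "Matrix.mat m m (\<lambda>(i, j). A (p i) j) = Matrix.mat m m (\<lambda>(i, j). ?M $$ (p i, j))"
    by (intro eq_matI) auto
  then show ?thesis
    using assms by (simp add: det_nat_eq_det det_permute_rows[of ?M m p] lessThan_atLeast0)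
qed
 
lemma det_nat_cong:
  assumes "\<And>i j. i < m \<Longrightarrow> j < m \<Longrightarrow> A i j = B i j"
  shows "det_nat m A = det_nat m B"
  unfolding det_nat_eq_det using assms by (intro arg_cong[of _ _ Determinant.det] eq_matI) auto

text \<open>Each inner product is expanded in coordinates, and the product of sums is distributed
  over all choices \<open>\<phi>\<close> of one column per row.\<close>

lemma pair_det_expand:
  fixes g A :: "nat \<Rightarrow> real^'n"
  shows "pair_det m g A =
    (\<Sum>\<phi>\<in>{..<m} \<rightarrow>\<^sub>E UNIV. (\<Prod>i<m. g i $ \<phi> i) * det_nat m (\<lambda>i j. A j $ \<phi> i))"
proof -
  have "pair_det m g A
      = (\<Sum>p | p permutes {..<m}. of_int (sign p) * (\<Prod>i<m. \<Sum>c\<in>UNIV. g i $ c * A (p i) $ c))"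
    by (simp add: pair_det_def det_nat_def inner_vec_def mult.commute)
  also have "\<dots> = (\<Sum>p | p permutes {..<m}. \<Sum>\<phi>\<in>{..<m} \<rightarrow>\<^sub>E UNIV.
      of_int (sign p) * (\<Prod>i<m. g i $ \<phi> i * A (p i) $ \<phi> i))"
    by (simp add: prod_sum_PiE sum_distrib_left)
  also have "\<dots> = (\<Sum>\<phi>\<in>{..<m} \<rightarrow>\<^sub>E UNIV. \<Sum>p | p permutes {..<m}.
      of_int (sign p) * (\<Prod>i<m. g i $ \<phi> i * A (p i) $ \<phi> i))"
    by (rule sum.swap)
  also have "\<dots> = (\<Sum>\<phi>\<in>{..<m} \<rightarrow>\<^sub>E UNIV. (\<Prod>i<m. g i $ \<phi> i) * det_nat m (\<lambda>i j. A j $ \<phi> i))"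
    by (simp add: det_nat_def prod.distrib sum_distrib_left mult_ac)
  finally show ?thesis .
qed

lemma bij_betw_sorted_nth:
  fixes I :: "'n::{finite,linorder} set"
  shows "bij_betw ((!) (sorted_list_of_set I)) {..<card I} I"
  by (rule bij_betw_nth) simp_all

text \<open>An injective choice of columns amounts to a set of columns and a permutation of its
  sorted order; this groups the terms of \<open>pair_det_expand\<close> into minors.\<close>

lemma bij_betw_subset_permutation:
  "bij_betw (\<lambda>(I, p). \<lambda>i\<in>{..<m}. sorted_list_of_set I ! p i)
    ({I. card I = m} \<times> {p. p permutes {..<m}})
    {\<phi> \<in> {..<m} \<rightarrow>\<^sub>E (UNIV :: 'n::{finite,linorder} set). inj_on \<phi> {..<m}}"
  (is "bij_betw ?h (?S \<times> ?P) ?T")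
proof -
  let ?e = "\<lambda>I :: 'n set. (!) (sorted_list_of_set I)"
  have e: "bij_betw (?e I) {..<m} I" if "card I = m" for I
    using bij_betw_sorted_nth[of I] that by simp
  have img: "?h (I, p) ` {..<m} = I" if "card I = m" "p permutes {..<m}" for I p
  proof -
    have "?h (I, p) ` {..<m} = ?e I ` p ` {..<m}" by auto
    then show ?thesis
      using e[OF that(1)] that(2) by (simp add: permutes_image bij_betw_def)
  qed
  show ?thesis
  proof (rule bij_betwI')
    fix x y assume "x \<in> ?S \<times> ?P" "y \<in> ?S \<times> ?P"
    then obtain I p J q where x: "x = (I, p)" "card I = m" "p permutes {..<m}"
      and y: "y = (J, q)" "card J = m" "q permutes {..<m}" by auto
    show "?h x = ?h y \<longleftrightarrow> x = y"
    proof
      assume eq: "?h x = ?h y"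
      then have "I = J" using img x y by metis
      moreover have "p i = q i" for i
      proof (cases "i < m")
        case True
        then have "?e I (p i) = ?e I (q i)"
          using fun_cong[OF eq, of i] x y \<open>I = J\<close> by simp
        moreover have "p i < m" "q i < m"
          using True x(3) y(3) permutes_in_image[of _ "{..<m}" i] by auto
        ultimately show ?thesis
          using bij_betw_imp_inj_on[OF e[OF x(2)]] by (auto dest: inj_onD)
      next
        case False
        then show ?thesis using x(3) y(3) by (simp add: permutes_not_in)
      qed
      ultimately show "x = y" using x y by auto
    qed simp
  next
    fix x assume "x \<in> ?S \<times> ?P"
    then obtain I p where x: "x = (I, p)" "card I = m" "p permutes {..<m}" by auto
    have "inj_on (?h x) {..<m}"
      using img[OF x(2,3)] x by (intro eq_card_imp_inj_on) auto
    then show "?h x \<in> ?T" using x by auto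
  next
    fix \<phi> assume "\<phi> \<in> ?T"
    then have \<phi>: "\<phi> \<in> {..<m} \<rightarrow>\<^sub>E UNIV" "inj_on \<phi> {..<m}" by auto
    define I where "I = \<phi> ` {..<m}"
    have card: "card I = m" using \<phi>(2) by (simp add: I_def card_image)
    have b\<phi>: "bij_betw \<phi> {..<m} I" using \<phi>(2) by (simp add: I_def bij_betw_def)
    \<comment> \<open>\<open>q i\<close> is the rank of \<open>\<phi> i\<close> in the image of
      \<open>\<phi>\<close>, extended by the identity as \<open>permutes\<close> requires.\<close>
    define q where "q = (\<lambda>i. if i < m then the_inv_into {..<m} (?e I) (\<phi> i) else i)"
    have "bij_betw (the_inv_into {..<m} (?e I) \<circ> \<phi>) {..<m} {..<m}"
      by (rule bij_betw_trans[OF b\<phi> bij_betw_the_inv_into[OF e[OF card]]])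
    then have "bij_betw q {..<m} {..<m}"
      by (rule bij_betw_cong[THEN iffD1, rotated]) (simp add: q_def)
    then have "q permutes {..<m}"
      by (rule bij_imp_permutes) (simp add: q_def)
    moreover have "?h (I, q) = \<phi>"
    proof
      fix i
      show "?h (I, q) i = \<phi> i"
      proof (cases "i < m")
        case True
        then have "\<phi> i \<in> I" by (simp add: I_def)
        then show ?thesis
          using True f_the_inv_into_f_bij_betw[OF e[OF card]] by (simp add: q_def)
      next
        case False
        then show ?thesis using \<phi>(1) by (auto simp: PiE_def extensional_def)
      qed
    qed
    ultimately show "\<exists>x\<in>?S \<times> ?P. \<phi> = ?h x"
      using card by (intro bexI[of _ "(I, q)"]) auto
  qed
qed

text \<open>Products of minors expand into the injective column choices; a choice that repeats a
  column contributes a determinant with two equal rows.\<close>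

lemma chow_form_eq_pair_det: "chow_form m g A = pair_det m g A"
proof -
  let ?e = "\<lambda>I :: 'a set. (!) (sorted_list_of_set I)"
  let ?t = "\<lambda>\<phi>. (\<Prod>i<m. g i $ \<phi> i) * det_nat m (\<lambda>i j. A j $ \<phi> i)"
  \<comment> \<open>The sign of \<open>p\<close> is absorbed by permuting the rows of the transposed
    minor of \<open>A\<close>.\<close>
  have perm: "(\<Prod>i<m. g i $ ?e I (p i)) * (of_int (sign p) * minor m A I)
      = ?t (\<lambda>i\<in>{..<m}. ?e I (p i))" if "p permutes {..<m}" for I p
  proof -
    have "of_int (sign p) * minor m A I = det_nat m (\<lambda>i j. A j $ ?e I (p i))"
      using det_nat_permute_rows[OF that, of "\<lambda>i j. A j $ ?e I i"]
      by (simp add: minor_def det_nat_transpose[of m "\<lambda>i j. A i $ ?e I j"])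
    also have "\<dots> = det_nat m (\<lambda>i j. A j $ (\<lambda>i\<in>{..<m}. ?e I (p i)) i)"
      by (rule det_nat_cong) simp
    finally show ?thesis by simp
  qed
  have "chow_form m g A = (\<Sum>I | card I = m. \<Sum>p | p permutes {..<m}.
      (\<Prod>i<m. g i $ ?e I (p i)) * (of_int (sign p) * minor m A I))"
    unfolding chow_form_def
    by (rule sum.cong) (simp_all add: minor_def[of m g] det_nat_def sum_distrib_left sum_distrib_right mult_ac)
  also have "\<dots> = (\<Sum>(I, p)\<in>{I. card I = m} \<times> {p. p permutes {..<m}}. ?t (\<lambda>i\<in>{..<m}. ?e I (p i)))"
    by (simp add: sum.cartesian_product[symmetric] perm)
  also have "\<dots> = (\<Sum>\<phi> | \<phi> \<in> {..<m} \<rightarrow>\<^sub>E UNIV \<and> inj_on \<phi> {..<m}. ?t \<phi>)"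
    using sum.reindex_bij_betw[OF bij_betw_subset_permutation[of m], of ?t]
    by (simp add: case_prod_unfold)
  also have "\<dots> = (\<Sum>\<phi>\<in>{..<m} \<rightarrow>\<^sub>E UNIV. ?t \<phi>)"
  proof (rule sum.mono_neutral_left)
    show "\<forall>\<phi>\<in>({..<m} \<rightarrow>\<^sub>E UNIV) - {\<phi> \<in> {..<m} \<rightarrow>\<^sub>E UNIV. inj_on \<phi> {..<m}}. ?t \<phi> = 0"
    proof
      fix \<phi> :: "nat \<Rightarrow> 'a"
      assume "\<phi> \<in> ({..<m} \<rightarrow>\<^sub>E UNIV) - {\<phi> \<in> {..<m} \<rightarrow>\<^sub>E UNIV. inj_on \<phi> {..<m}}"
      then obtain i j where "i < m" "j < m" "i \<noteq> j" "\<phi> i = \<phi> j" by (auto simp: inj_on_def)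
      then have "det_nat m (\<lambda>i j. A j $ \<phi> i) = 0"
        by (intro det_nat_identical_rows[of i m j]) auto
      then show "?t \<phi> = 0" by simp
    qed
  qed (auto intro: finite_PiE)
  also have "\<dots> = pair_det m g A" by (rule pair_det_expand[symmetric])
  finally show ?thesis .
qed

section \<open>Faces of pointed polyhedral cones\<close>

text \<open>The convex cone hull of a finite set is a polyhedron, so its faces are exposed and
  relative boundaries are unions of facets.\<close>

lemma polycone_eq_hull:
  assumes "finite S"
  shows "polycone S = convex_cone hull S"
proof (rule hull_unique[symmetric])
  show "S \<subseteq> polycone S"
  proof
    fix v assume "v \<in> S"
    then have "v = (\<Sum>w\<in>S. (if w = v then 1 else 0) *\<^sub>R w)"
      using assms by (simp add: if_distrib[of "\<lambda>c. c *\<^sub>R _"] cong: if_cong)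
    then show "v \<in> polycone S"
      unfolding polycone_def by (intro CollectI exI[of _ "\<lambda>w. if w = v then 1 else 0"]) auto
  qed
  show "convex_cone (polycone S)"
    unfolding convex_cone_iff
  proof (intro conjI ballI allI impI)
    show "0 \<in> polycone S"
      unfolding polycone_def by (intro CollectI exI[of _ "\<lambda>_. 0"]) auto
  next
    fix x y assume "x \<in> polycone S" "y \<in> polycone S"
    then obtain c d where "\<forall>v\<in>S. 0 \<le> c v" "x = (\<Sum>v\<in>S. c v *\<^sub>R v)"
      "\<forall>v\<in>S. 0 \<le> d v" "y = (\<Sum>v\<in>S. d v *\<^sub>R v)"
      unfolding polycone_def by auto
    then show "x + y \<in> polycone S"
      unfolding polycone_def
      by (intro CollectI exI[of _ "\<lambda>v. c v + d v"]) (auto simp: scaleR_add_left sum.distrib)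
  next
    fix x and t :: real assume "x \<in> polycone S" "0 \<le> t"
    then obtain c where "\<forall>v\<in>S. 0 \<le> c v" "x = (\<Sum>v\<in>S. c v *\<^sub>R v)"
      unfolding polycone_def by auto
    with \<open>0 \<le> t\<close> show "t *\<^sub>R x \<in> polycone S"
      unfolding polycone_def
      by (intro CollectI exI[of _ "\<lambda>v. t * c v"]) (auto simp: scaleR_sum_right)
  qed
next
  fix T assume T: "S \<subseteq> T" "convex_cone T"
  show "polycone S \<subseteq> T"
  proof
    fix x assume "x \<in> polycone S"
    then obtain c where c: "\<forall>v\<in>S. 0 \<le> c v" "x = (\<Sum>v\<in>S. c v *\<^sub>R v)"
      unfolding polycone_def by auto
    have "(\<Sum>v\<in>R. c v *\<^sub>R v) \<in> T" if "R \<subseteq> S" for R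
      using finite_subset[OF that assms] that
    proof (induction R rule: finite_induct)
      case empty
      show ?case by (simp add: T convex_cone_contains_0)
    next
      case (insert v R)
      then show ?case using T c by (auto intro!: convex_cone_add convex_cone_scaleR)
    qed
    then show "x \<in> T" using c by simp
  qed
qed

locale pointed_polycone =
  fixes S :: "'a::euclidean_space set" and a :: 'a
  assumes finite_S: "finite S" and pos_S: "\<And>v. v \<in> S \<Longrightarrow> 0 < a \<bullet> v"
begin

abbreviation K :: "'a set" where "K \<equiv> polycone S"

text \<open>Without the empty face every face contains the apex 0, so affine hulls are spans and
  \<open>dim\<close> can stand for \<open>aff_dim\<close>. The face \<open>{0}\<close> corresponds
  to the empty face of the polytope.\<close>

definition cface :: "'a set \<Rightarrow> bool" where "cface F \<longleftrightarrow> F face_of K \<and> F \<noteq> {}"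

lemma convex_cone_K: "convex_cone K"
  by (simp add: polycone_eq_hull finite_S convex_cone_convex_cone_hull)

lemma polyhedron_K: "polyhedron K"
  by (simp add: polycone_eq_hull finite_S polyhedron_convex_cone_hull)

lemma convex_K: "convex K"
  using convex_cone_K unfolding convex_cone_def by blast

lemma S_subset_K: "S \<subseteq> K"
  by (simp add: polycone_eq_hull finite_S hull_subset)

lemma zero_in_K: "0 \<in> K"
  using convex_cone_K by (rule convex_cone_contains_0)

lemma inner_K_nonneg:
  assumes "\<And>v. v \<in> S \<Longrightarrow> 0 \<le> b \<bullet> v" "x \<in> K"
  shows "0 \<le> b \<bullet> x"
  using assms by (auto simp: polycone_def inner_sum_right intro!: sum_nonneg)

lemma inner_K_pos:
  assumes "x \<in> K" "x \<noteq> 0"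
  shows "0 < a \<bullet> x"
proof -
  obtain c where c: "\<forall>v\<in>S. 0 \<le> c v" "x = (\<Sum>v\<in>S. c v *\<^sub>R v)"
    using assms(1) unfolding polycone_def by auto
  obtain v where "v \<in> S" "c v \<noteq> 0"
    using assms(2) c(2) sum.neutral[of S "\<lambda>v. c v *\<^sub>R v"] by force
  then have "0 < c v * (a \<bullet> v)" using c(1) pos_S by (simp add: order_less_le)
  then have "0 < (\<Sum>v\<in>S. c v * (a \<bullet> v))"
    using \<open>v \<in> S\<close> c(1) pos_S finite_S by (intro sum_pos2[of _ v]) (auto simp: less_imp_le)
  then show ?thesis by (simp add: c(2) inner_sum_right)
qed

text \<open>All terms of \<open>a \<bullet> x\<close> are nonnegative, so its value bounds each
  coefficient separately.\<close>

lemma bounded_slice: "bounded {x \<in> K. a \<bullet> x = \<alpha>}"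
proof -
  have "norm x \<le> (\<Sum>v\<in>S. \<alpha> / (a \<bullet> v) * norm v)" if x: "x \<in> K" "a \<bullet> x = \<alpha>" for x
  proof -
    obtain c where c: "\<forall>v\<in>S. 0 \<le> c v" "x = (\<Sum>v\<in>S. c v *\<^sub>R v)"
      using x(1) unfolding polycone_def by auto
    have "c v \<le> \<alpha> / (a \<bullet> v)" if "v \<in> S" for v
    proof -
      have "c v * (a \<bullet> v) \<le> (\<Sum>v\<in>S. c v * (a \<bullet> v))"
        using that c(1) pos_S finite_S by (intro member_le_sum) (auto simp: less_imp_le)
      also have "\<dots> = \<alpha>" using x(2) by (simp add: c(2) inner_sum_right)
      finally show ?thesis using pos_S[OF that] by (simp add: pos_le_divide_eq)
    qed
    then show ?thesis
      unfolding c(2) using c(1) by (intro sum_norm_le) (simp add: mult_right_mono del: times_divide_eq_left)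
  qed
  then show ?thesis unfolding bounded_iff by blast
qed

lemma cface_K: "cface K"
  using zero_in_K by (auto simp: cface_def face_of_refl convex_K)

lemma cface_subset: "cface F \<Longrightarrow> F \<subseteq> K"
  by (simp add: cface_def face_of_imp_subset)

text \<open>A nonzero point \<open>x\<close> of the face is the midpoint of 0 and
  \<open>2 *\<^sub>R x\<close>, which both lie in the cone and hence in the face.\<close>

lemma cface_zero:
  assumes "cface F"
  shows "0 \<in> F"
proof -
  obtain x where x: "x \<in> F" using assms by (auto simp: cface_def)
  show ?thesis
  proof (cases "x = 0")
    case False
    have "x \<in> K" using x assms cface_subset by blast
    then have "2 *\<^sub>R x \<in> K" by (simp add: convex_cone_scaleR[OF convex_cone_K])
    moreover have "x \<in> open_segment 0 (2 *\<^sub>R x)"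
      using False by (auto simp: in_segment intro!: exI[of _ "1/2"])
    ultimately show ?thesis
      using assms x zero_in_K unfolding cface_def face_of_def by blast
  qed (use x in simp)
qed

lemma cface_affine_hull: "cface F \<Longrightarrow> affine hull F = span F"
  by (rule affine_hull_span_0) (simp add: cface_zero hull_inc)

lemma cface_eq_span_Int: "cface F \<Longrightarrow> F = span F \<inter> K"
  using face_of_imp_eq_affine_Int[OF convex_K, of F] cface_affine_hull[of F]
  by (simp add: cface_def)

lemma cface_aff_dim: "cface F \<Longrightarrow> aff_dim F = int (dim F)"
  by (simp add: aff_dim_zero cface_zero hull_inc)

lemma cface_convex_cone:
  assumes "cface F"
  shows "convex_cone F"
proof -
  have "convex_cone (span F)" by (simp add: convex_cone_iff span_add span_scale span_zero)
  then have "convex_cone (span F \<inter> K)"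
    using convex_cone_K by (auto simp: convex_cone_iff)
  then show ?thesis using cface_eq_span_Int[OF assms] by simp
qed

lemma cface_polyhedron: "cface F \<Longrightarrow> polyhedron F"
  using polyhedron_K face_of_polyhedron_polyhedron by (auto simp: cface_def)

lemma cface_eqI:
  assumes "cface F" "cface H" "F \<subseteq> H" "dim H \<le> dim F"
  shows "F = H"
  using assms cface_eq_span_Int dim_eq_span by metis

lemma cface_face_of: "cface F \<Longrightarrow> cface H \<Longrightarrow> F \<subseteq> H \<Longrightarrow> F face_of H"
  using face_of_subset[of F K H] by (simp add: cface_def face_of_imp_subset)

lemma cface_trans: "cface H \<Longrightarrow> F face_of H \<Longrightarrow> F \<noteq> {} \<Longrightarrow> cface F"
  unfolding cface_def using face_of_trans by blast

lemma cface_facet: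
  assumes "cface H" "G facet_of H"
  shows "cface G" "G \<subseteq> H" "dim H = Suc (dim G)"
proof -
  show "cface G"
    using assms cface_trans by (auto simp: facet_of_def)
  then show "G \<subseteq> H" "dim H = Suc (dim G)"
    using assms cface_aff_dim[of G] cface_aff_dim[of H]
    by (auto simp: facet_of_def dest: face_of_imp_subset)
qed

lemma cface_expose:
  assumes "cface F"
  obtains b where "\<And>x. x \<in> K \<Longrightarrow> 0 \<le> b \<bullet> x" "\<And>x. x \<in> K \<Longrightarrow> b \<bullet> x = 0 \<longleftrightarrow> x \<in> F"
proof -
  have "F exposed_face_of K"
    using assms polyhedron_K exposed_face_of_polyhedron by (auto simp: cface_def)
  then obtain b \<beta> where b: "K \<subseteq> {x. b \<bullet> x \<le> \<beta>}" "F = K \<inter> {x. b \<bullet> x = \<beta>}"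
    unfolding exposed_face_of_def by blast
  \<comment> \<open>The apex lies on the supporting hyperplane, which is therefore linear.\<close>
  have "\<beta> = 0" using cface_zero[OF assms] b(2) by simp
  with b show ?thesis by (intro that[of "- b"]) auto
qed

lemma inner_zero_on_span: "(\<And>x. x \<in> F \<Longrightarrow> b \<bullet> x = 0) \<Longrightarrow> x \<in> span F \<Longrightarrow> b \<bullet> x = 0" for b x :: 'a
  using span_induct[OF _ subspace_hyperplane] by blast

text \<open>Descend from \<open>H\<close> through facets containing \<open>F\<close> until
  \<open>F\<close> itself is a facet.\<close>

lemma cface_cover:
  assumes "cface F" "cface H" "F \<subset> H"
  shows "\<exists>E. cface E \<and> F \<subseteq> E \<and> E \<subseteq> H \<and> dim E = Suc (dim F)"
  using assms
proof (induction "dim H" arbitrary: H rule: less_induct)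
  case less
  obtain H' where H': "H' facet_of H" "F \<subseteq> H'"
    using face_of_polyhedron_subset_facet[OF cface_polyhedron[OF less.prems(2)]]
      cface_face_of[OF less.prems(1,2)] less.prems by (metis cface_def psubset_imp_subset less_irrefl)
  note f = cface_facet[OF less.prems(2) H'(1)]
  show ?case
  proof (cases "F = H'")
    case True
    with f less.prems show ?thesis by auto
  next
    case False
    with H' f less.prems less.hyps[of H'] show ?thesis by (metis lessI order_trans psubsetI)
  qed
qed

section \<open>Relative interiors and rays leaving a face\<close>

lemma cface_boundary:
  assumes "cface H" "x \<in> H" "x \<notin> rel_interior H"
  obtains G where "cface G" "G \<subseteq> H" "x \<in> G" "dim H = Suc (dim G)"
proof -
  obtain G where "G facet_of H" "x \<in> G"
    using assms rel_interior_of_polyhedron[OF cface_polyhedron[OF assms(1)]] by blast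
  then show ?thesis using that cface_facet[OF assms(1)] by blast
qed

lemma rel_interior_move:
  assumes "cface H" "y \<in> rel_interior H" "d \<in> span H"
  obtains \<epsilon> where "0 < \<epsilon>" "y + \<epsilon> *\<^sub>R d \<in> H"
proof -
  have "convex H" using assms(1) by (simp add: cface_convex_cone[unfolded convex_cone_def])
  moreover have "y - d \<in> affine hull H"
    using assms rel_interior_subset cface_affine_hull by (metis span_base span_diff subsetD)
  ultimately obtain e where e: "1 < e" "(1 - e) *\<^sub>R (y - d) + e *\<^sub>R y \<in> H"
    using convex_rel_interior_if2[of H y] assms(2) by blast
  moreover have "(1 - e) *\<^sub>R (y - d) + e *\<^sub>R y = y + (e - 1) *\<^sub>R d"
    by (simp add: algebra_simps)
  ultimately show ?thesis using that[of "e - 1"] by simp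
qed

text \<open>Orthogonality to \<open>a\<close> keeps the ray in a bounded slice, so the parameters at
  which it is in \<open>H\<close> form a compact set. At the largest one the point is not relatively
  interior, since from such a point the ray could be prolonged within \<open>H\<close>.\<close>

lemma cface_exit:
  assumes H: "cface H" and y: "y \<in> H" and d: "d \<in> span H" "d \<noteq> 0" "a \<bullet> d = 0"
  obtains t where "0 \<le> t" "y + t *\<^sub>R d \<in> H" "y + t *\<^sub>R d \<notin> rel_interior H"
    "\<And>s. 0 \<le> s \<Longrightarrow> y + s *\<^sub>R d \<in> H \<Longrightarrow> s \<le> t"
proof -
  let ?T = "{t. 0 \<le> t \<and> y + t *\<^sub>R d \<in> H}"
  obtain r where r: "\<And>x. x \<in> K \<Longrightarrow> a \<bullet> x = a \<bullet> y \<Longrightarrow> norm x \<le> r"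
    using bounded_slice[of "a \<bullet> y"] unfolding bounded_iff by blast
  have "norm t \<le> (r + norm y) / norm d" if "t \<in> ?T" for t
  proof -
    have "norm (y + t *\<^sub>R d) \<le> r"
      using that cface_subset[OF H] d(3) by (intro r) (auto simp: inner_add_right)
    moreover have "norm (t *\<^sub>R d) \<le> norm (y + t *\<^sub>R d) + norm y"
      by (metis add_diff_cancel_left' norm_triangle_ineq4)
    ultimately show ?thesis using d(2) by (simp add: pos_le_divide_eq)
  qed
  then have "bounded ?T" unfolding bounded_iff by blast
  moreover have "closed ?T"
  proof -
    have "closed {t. y + t *\<^sub>R d \<in> H}"
      using closed_vimage[OF polyhedron_imp_closed[OF cface_polyhedron[OF H]], of "\<lambda>t. y + t *\<^sub>R d"]
      by (simp add: vimage_def continuous_intros)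
    then show ?thesis
      using closed_Int[OF closed_atLeast[of 0]] by (simp add: Collect_conj_eq atLeast_def)
  qed
  moreover have "0 \<in> ?T" using y by simp
  ultimately obtain t where t: "t \<in> ?T" "\<And>s. s \<in> ?T \<Longrightarrow> s \<le> t"
    using compact_attains_sup[of ?T] compact_eq_bounded_closed by blast
  have "y + t *\<^sub>R d \<notin> rel_interior H"
  proof
    assume "y + t *\<^sub>R d \<in> rel_interior H"
    then obtain \<epsilon> where "0 < \<epsilon>" "y + t *\<^sub>R d + \<epsilon> *\<^sub>R d \<in> H"
      using rel_interior_move[OF H _ d(1)] by blast
    then show False using t(1) t(2)[of "t + \<epsilon>"] by (simp add: algebra_simps)
  qed
  with t show ?thesis by (intro that) auto
qed

text \<open>The segment from \<open>y\<close> to \<open>z\<close> cannot meet a facet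
  \<open>G\<close> while in \<open>F\<close>, because some functional vanishing on \<open>G\<close>
  is positive at both ends. So the last parameter at which it is in \<open>F\<close> is 1.\<close>

lemma rel_interior_cfaceI:
  assumes F: "cface F" and y: "y \<in> rel_interior F" and z: "z \<in> span F"
    and sep: "\<And>G. cface G \<Longrightarrow> G \<subseteq> F \<Longrightarrow> dim F = Suc (dim G) \<Longrightarrow>
      \<exists>b. (\<forall>x\<in>G. b \<bullet> x = 0) \<and> 0 < b \<bullet> y \<and> 0 < b \<bullet> z"
  shows "z \<in> rel_interior F"
proof -
  let ?p = "\<lambda>t::real. (1 - t) *\<^sub>R y + t *\<^sub>R z"
  let ?T = "{0..1} \<inter> {t. ?p t \<in> F}"
  have conv: "convex F" using F by (simp add: cface_convex_cone[unfolded convex_cone_def])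
  have int: "?p t \<in> rel_interior F" if "t \<in> ?T" for t
  proof (rule ccontr)
    have mem: "?p t \<in> F" using that by simp
    assume "?p t \<notin> rel_interior F"
    then obtain G where G: "cface G" "G \<subseteq> F" "?p t \<in> G" "dim F = Suc (dim G)"
      by (rule cface_boundary[OF F mem])
    obtain b where b: "\<forall>x\<in>G. b \<bullet> x = 0" "0 < b \<bullet> y" "0 < b \<bullet> z"
      using sep[OF G(1,2,4)] by blast
    have "(1 - t) * (b \<bullet> y) + t * (b \<bullet> z) = 0"
      using b(1) G(3) by (force simp: inner_add_right)
    moreover have "0 < (1 - t) * (b \<bullet> y) + t * (b \<bullet> z)"
    proof (cases "t = 0")
      case False
      then show ?thesis using that b by (intro add_nonneg_pos) auto
    qed (use b in simp)
    ultimately show False by simp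
  qed
  have "closed {t. ?p t \<in> F}"
    using closed_vimage[OF polyhedron_imp_closed[OF cface_polyhedron[OF F]], of ?p]
    by (simp add: vimage_def continuous_intros)
  then have "compact ?T" by (rule compact_Int_closed[OF compact_Icc])
  moreover have "0 \<in> ?T" using y rel_interior_subset by auto
  ultimately obtain t where t: "t \<in> ?T" "\<And>s. s \<in> ?T \<Longrightarrow> s \<le> t"
    using compact_attains_sup[of ?T] by blast
  have "t = 1"
  proof (rule ccontr)
    assume "t \<noteq> 1"
    with t(1) have "t < 1" by auto
    have "z - y \<in> span F" using z y rel_interior_subset by (blast intro: span_diff span_base)
    then obtain \<epsilon> where \<epsilon>: "0 < \<epsilon>" "?p t + \<epsilon> *\<^sub>R (z - y) \<in> F"
      using rel_interior_move[OF F int[OF t(1)]] by blast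
    \<comment> \<open>The step is shortened so that the parameter stays within the segment.\<close>
    define \<delta> where "\<delta> = min \<epsilon> (1 - t)"
    have \<delta>: "0 < \<delta>" "\<delta> \<le> \<epsilon>" "t + \<delta> \<le> 1" using \<epsilon>(1) \<open>t < 1\<close> by (auto simp: \<delta>_def)
    have "(1 - \<delta> / \<epsilon>) *\<^sub>R ?p t + (\<delta> / \<epsilon>) *\<^sub>R (?p t + \<epsilon> *\<^sub>R (z - y)) \<in> F"
      by (rule convexD[OF conv]) (use t(1) \<epsilon> \<delta> in auto)
    moreover have "(1 - \<delta> / \<epsilon>) *\<^sub>R ?p t + (\<delta> / \<epsilon>) *\<^sub>R (?p t + \<epsilon> *\<^sub>R (z - y)) = ?p (t + \<delta>)"
      using \<epsilon>(1) by (simp add: algebra_simps)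
    ultimately have "t + \<delta> \<in> ?T" using \<delta> t(1) by auto
    then show False using t(2) \<delta>(1) by fastforce
  qed
  then show ?thesis using int[OF t(1)] by simp
qed

text \<open>If \<open>t\<close> is the maximum of \<open>L/b\<close> over the generators outside \<open>F\<close>, where \<open>b\<close> exposes \<open>F\<close>, then
  \<open>t b - L\<close> exposes a face strictly containing \<open>F\<close>, on which \<open>L = t b\<close>; hence \<open>t \<le> 0\<close>.\<close>

lemma cface_local_opt:
  assumes F: "cface F" and zero: "\<And>x. x \<in> F \<Longrightarrow> L \<bullet> x = 0"
    and le: "\<And>E x. cface E \<Longrightarrow> F \<subseteq> E \<Longrightarrow> dim E = Suc (dim F) \<Longrightarrow> x \<in> E \<Longrightarrow> L \<bullet> x \<le> 0"
    and x: "x \<in> K"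
  shows "L \<bullet> x \<le> 0"
proof -
  obtain b where b: "\<And>x. x \<in> K \<Longrightarrow> 0 \<le> b \<bullet> x" "\<And>x. x \<in> K \<Longrightarrow> b \<bullet> x = 0 \<longleftrightarrow> x \<in> F"
    by (rule cface_expose[OF F]) blast
  have bpos: "0 < b \<bullet> v" if "v \<in> S - F" for v
    using that b[of v] S_subset_K by force
  have fin: "finite (S - F)" using finite_S by simp
  have "0 \<le> (- L) \<bullet> v" if v: "v \<in> S" for v
  proof (cases "v \<in> F")
    case False
    let ?r = "\<lambda>v. (L \<bullet> v) / (b \<bullet> v)"
    obtain w where w: "w \<in> S - F" "\<And>u. u \<in> S - F \<Longrightarrow> ?r u \<le> ?r w"
    proof (rule that)
      have ne: "S - F \<noteq> {}" using v False by blast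
      show "arg_min_on (\<lambda>u. - ?r u) (S - F) \<in> S - F"
        by (rule arg_min_if_finite(1)[OF fin ne])
      show "?r u \<le> ?r (arg_min_on (\<lambda>u. - ?r u) (S - F))" if "u \<in> S - F" for u
        using arg_min_least[OF fin ne that, of "\<lambda>u. - ?r u"] by simp
    qed
    let ?t = "?r w"
    have le_t: "0 \<le> (?t *\<^sub>R b - L) \<bullet> u" if "u \<in> S" for u
    proof (cases "u \<in> F")
      case True
      then have "b \<bullet> u = 0" "L \<bullet> u = 0" using zero b(2) S_subset_K that by auto
      then show ?thesis by (simp add: inner_diff_left)
    next
      case False
      then show ?thesis
        using that w(2)[of u] bpos[of u] by (simp add: inner_diff_left pos_divide_le_eq)
    qed
    let ?H = "K \<inter> {x. (?t *\<^sub>R b - L) \<bullet> x = 0}"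
    have "?H face_of K"
      using inner_K_nonneg[OF le_t] by (intro face_of_Int_supporting_hyperplane_ge convex_K) auto
    moreover have "0 \<in> ?H" using zero_in_K by simp
    ultimately have H: "cface ?H" by (auto simp: cface_def)
    have "F \<subseteq> ?H" using zero b(2) cface_subset[OF F] by (auto simp: inner_diff_left)
    moreover have "w \<in> ?H" using w(1) S_subset_K bpos[OF w(1)] by (auto simp: inner_diff_left)
    ultimately have "F \<subset> ?H" using w(1) by blast
    then obtain E where E: "cface E" "F \<subseteq> E" "E \<subseteq> ?H" "dim E = Suc (dim F)"
      using cface_cover[OF F H] by blast
    then obtain e where e: "e \<in> E" "e \<notin> F" by (metis n_not_Suc_n subsetI subset_antisym)
    then have "e \<in> K" using cface_subset[OF E(1)] by blast
    then have "0 < b \<bullet> e" using b[of e] e(2) by auto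
    moreover have "?t * (b \<bullet> e) = L \<bullet> e" using e(1) E(3) by (auto simp: inner_diff_left)
    moreover have "L \<bullet> e \<le> 0" using le[OF E(1,2,4) e(1)] .
    ultimately have "?t \<le> 0" by (metis mult_le_0_iff not_less)
    then show ?thesis
      using w(2)[of v] v False bpos[of v] by (auto simp: divide_le_0_iff dest!: order_trans[of _ "?t" 0])
  qed (use zero in simp)
  then have "0 \<le> (- L) \<bullet> x" using x by (rule inner_K_nonneg)
  then show ?thesis by simp
qed

end

section \<open>Stabbed faces\<close>

context pointed_polycone
begin

definition stabbed :: "nat \<Rightarrow> 'a set \<Rightarrow> 'a set set" where
  "stabbed p U = {F. cface F \<and> dim F = p \<and> (\<exists>x\<in>U. x \<in> rel_interior F \<and> x \<noteq> 0)}"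

lemma finite_stabbed: "finite (stabbed p U)"
  by (rule finite_subset[OF _ finite_polyhedron_faces[OF polyhedron_K]])
    (auto simp: stabbed_def cface_def)

lemma span_cface_insert:
  assumes "cface F" "cface E" "F \<subseteq> E" "dim E = Suc (dim F)" "u \<in> span E" "u \<notin> span F"
  shows "span E = span (insert u F)"
proof -
  have "span (insert u F) \<subseteq> span E"
    using assms by (metis insert_subset order_trans span_minimal span_superset subspace_span)
  moreover have "dim (span E) \<le> dim (span (insert u F))"
    using assms by (simp add: dim_insert)
  ultimately show ?thesis
    using subspace_dim_equal[of "span (insert u F)" "span E"] by simp
qed

lemma not_in_span_cface: "cface F \<Longrightarrow> u \<in> K \<Longrightarrow> u \<notin> F \<Longrightarrow> u \<notin> span F"
  using cface_eq_span_Int by blast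

text \<open>A face containing a relative interior point of \<open>F'\<close> contains all of
  \<open>F'\<close>, which the dimensions forbid.\<close>

lemma rel_interior_not_in_cface:
  assumes "cface F" "cface F'" "F' \<noteq> F" "dim F \<le> dim F'" "x \<in> rel_interior F'"
  shows "x \<notin> F"
proof
  assume "x \<in> F"
  then have "F' \<subseteq> F"
    using assms subset_of_face_of[of F K F'] cface_subset by (auto simp: cface_def)
  then show False using assms cface_eqI by blast
qed

text \<open>Since \<open>U\<close> and \<open>span F\<close> sum to the whole space, their
  intersection has dimension \<open>dim U + dim F - DIM('a)\<close>, which is 1.\<close>

lemma unique_direction:
  fixes U F :: "'a set"
  assumes "subspace U" "dim U + dim F = Suc DIM('a)" "y \<in> U" "y \<in> span F" "y \<noteq> 0"
    and full: "\<And>x. \<exists>u\<in>U. \<exists>f\<in>span F. x = u + f"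
  shows "U \<inter> span F = span {y}"
proof -
  have "{u + f |u f. u \<in> U \<and> f \<in> span F} = UNIV" using full by blast
  then have "dim (U \<inter> span F) = 1"
    using dim_sums_Int[OF assms(1) subspace_span, of F] assms(2) by simp
  moreover have "span {y} \<subseteq> U \<inter> span F"
    using assms by (intro span_minimal) (auto intro: subspace_inter)
  moreover have "dim (span {y}) = 1" using assms(5) by simp
  ultimately show ?thesis
    using subspace_dim_equal[OF subspace_span subspace_inter[OF assms(1) subspace_span], of "{y}" F]
    by simp
qed

text \<open>\<open>l\<close> is orthogonal to the intersection of \<open>U\<close> and
  \<open>X\<close>, hence a sum of a vector orthogonal to \<open>U\<close> and one orthogonal to
  \<open>X\<close>; the latter is the functional sought. The proof projects \<open>l\<close> onto
  the sum of the two complements and shows that the remainder \<open>n\<close> is zero.\<close>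

lemma extend_functional:
  assumes U: "subspace U" and X: "subspace X" and int: "U \<inter> X = span {y}" and l: "l \<bullet> y = 0"
  obtains L :: 'a where "\<And>x. x \<in> X \<Longrightarrow> L \<bullet> x = 0" "\<And>u. u \<in> U \<Longrightarrow> L \<bullet> u = l \<bullet> u"
proof -
  let ?W = "{u + x |u x. u \<in> U\<^sup>\<bottom> \<and> x \<in> X\<^sup>\<bottom>}"
  have W: "subspace ?W" by (intro subspace_sums subspace_orthogonal_comp)
  obtain w n where wn: "w \<in> ?W" "n \<in> ?W\<^sup>\<bottom>" "l = w + n"
  proof -
    have "l \<in> ?W + ?W\<^sup>\<bottom>" using subspace_sum_orthogonal_comp[OF W] by simp
    then show ?thesis using that by (rule set_plus_elim)
  qed
  have "U\<^sup>\<bottom> \<subseteq> ?W" "X\<^sup>\<bottom> \<subseteq> ?W"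
    using subspace_0[OF subspace_orthogonal_comp] by force+
  then have "n \<in> U \<inter> X"
    using wn(2) orthogonal_comp_anti_mono[of "U\<^sup>\<bottom>" ?W] orthogonal_comp_anti_mono[of "X\<^sup>\<bottom>" ?W]
      orthogonal_comp_self[OF U] orthogonal_comp_self[OF X] by auto
  then obtain s where "n = s *\<^sub>R y" using int by (auto simp: span_singleton)
  moreover have "w \<bullet> n = 0"
    using wn(1,2) by (auto simp: orthogonal_comp_def Linear_Algebra.orthogonal_def)
  ultimately have "n \<bullet> n = 0" using l wn(3) by (metis inner_add_left inner_scaleR_right add_0 mult_zero_right)
  then obtain u x where ux: "u \<in> U\<^sup>\<bottom>" "x \<in> X\<^sup>\<bottom>" "l = u + x" using wn by auto
  show ?thesis
  proof (rule that)
    show "x \<bullet> z = 0" if "z \<in> X" for z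
      using ux(2) that by (auto simp: orthogonal_comp_def Linear_Algebra.orthogonal_def inner_commute)
    show "x \<bullet> z = l \<bullet> z" if "z \<in> U" for z
      using ux(1,3) that by (auto simp: orthogonal_comp_def Linear_Algebra.orthogonal_def inner_commute inner_add_right)
  qed
qed

end

section \<open>Full-dimensional cones: transversality and connectedness\<close>

locale full_pointed_polycone = pointed_polycone +
  assumes dim_S: "dim S = DIM('a)"
begin

lemma span_S: "span S = UNIV"
  using dim_S dim_eq_full by blast

text \<open>A functional killing \<open>U\<close> and \<open>F\<close> kills every face
  \<open>E\<close> just above \<open>F\<close>, as \<open>E\<close> is spanned by \<open>F\<close>
  and a point of \<open>U\<close>. Local optimality of \<open>L\<close> and of \<open>- L\<close>
  then makes it vanish on the full-dimensional cone.\<close>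

lemma complement_of_neighbours:
  assumes F: "cface F" and U: "subspace U"
    and nb: "\<And>E. cface E \<Longrightarrow> F \<subseteq> E \<Longrightarrow> dim E = Suc (dim F) \<Longrightarrow> \<exists>u\<in>U. u \<in> E \<and> u \<notin> F"
  shows "\<exists>u\<in>U. \<exists>f\<in>span F. x = u + f"
proof -
  let ?T = "{u + f |u f. u \<in> U \<and> f \<in> span F}"
  have T: "subspace ?T" by (intro subspace_sums U subspace_span)
  have "?T = UNIV"
  proof (rule ccontr)
    assume "?T \<noteq> UNIV"
    then have "dim ?T < DIM('a)"
      using T by (metis (lifting) dim_eq_full dim_subset_UNIV order_le_less span_eq_iff)
    then obtain L where L: "L \<noteq> 0" "\<And>y. y \<in> span ?T \<Longrightarrow> L \<bullet> y = 0"
      using orthogonal_to_subspace_exists[of ?T] unfolding Linear_Algebra.orthogonal_def by blast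
    have LU: "L \<bullet> u = 0" if "u \<in> U" for u
    proof -
      have "u \<in> ?T" using that span_zero by force
      then show ?thesis by (intro L(2) span_base)
    qed
    have LF: "L \<bullet> f = 0" if "f \<in> span F" for f
    proof -
      have "f \<in> ?T" using that subspace_0[OF U] by force
      then show ?thesis by (intro L(2) span_base)
    qed
    have LE: "L \<bullet> z = 0" if E: "cface E" "F \<subseteq> E" "dim E = Suc (dim F)" and z: "z \<in> E" for E z
    proof -
      obtain u where u: "u \<in> U" "u \<in> E" "u \<notin> F" using nb[OF E] by blast
      then have "u \<in> span E" "u \<notin> span F"
        using not_in_span_cface[OF F] cface_subset[OF E(1)] span_base by blast+
      then have "z \<in> span (insert u F)"
        using z span_cface_insert[OF F E] span_base by blast
      then show ?thesis
        by (rule inner_zero_on_span[rotated]) (use LU LF u(1) span_base in auto)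
    qed
    have "L \<bullet> v = 0" if "v \<in> S" for v
    proof -
      have v: "v \<in> K" using that S_subset_K by blast
      have "L \<bullet> v \<le> 0"
        by (rule cface_local_opt[OF F _ _ v]) (simp_all add: LF[OF span_base] LE)
      moreover have "(- L) \<bullet> v \<le> 0"
        by (rule cface_local_opt[OF F _ _ v]) (simp_all add: LF[OF span_base] LE)
      ultimately show ?thesis by simp
    qed
    then have "L \<bullet> L = 0" by (rule inner_zero_on_span[of S]) (simp_all only: span_S UNIV_I)
    with L(1) show False by simp
  qed
  then show ?thesis by blast
qed

text \<open>Let \<open>b\<close> expose a stabbed face \<open>F0\<close> outside \<open>C\<close>, and let \<open>b/a\<close> be minimal over \<open>C\<close> at \<open>F\<close>, with value
  \<open>q > 0\<close>. Then \<open>q a - b\<close> is locally, hence globally, maximal at \<open>F\<close> with value \<open>0\<close>, but it is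
  positive where \<open>U\<close> meets \<open>F0\<close>.\<close>

lemma stabbed_subset_if_closed:
  assumes U: "subspace U" "dim U + p = Suc DIM('a)"
    and C: "C \<subseteq> stabbed p U" "C \<noteq> {}"
    and nb: "\<And>F E. F \<in> C \<Longrightarrow> cface E \<Longrightarrow> F \<subseteq> E \<Longrightarrow> dim E = Suc p \<Longrightarrow> \<exists>F'\<in>C. F' \<noteq> F \<and> F' \<subseteq> E"
  shows "stabbed p U \<subseteq> C"
proof
  fix F0 assume "F0 \<in> stabbed p U"
  then obtain r where F0: "cface F0" "dim F0 = p" and r: "r \<in> U" "r \<in> rel_interior F0" "r \<noteq> 0"
    by (auto simp: stabbed_def)
  have rK: "r \<in> K" and rF0: "r \<in> F0"
    using r(2) rel_interior_subset cface_subset[OF F0(1)] by blast+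
  have fin: "finite C" using C(1) finite_stabbed finite_subset by blast
  have "\<exists>y. y \<in> U \<and> y \<in> rel_interior F \<and> y \<noteq> 0" if "F \<in> C" for F
    using that C(1) by (auto simp: stabbed_def)
  then obtain y where y: "\<And>F. F \<in> C \<Longrightarrow> y F \<in> U \<and> y F \<in> rel_interior F \<and> y F \<noteq> 0" by metis
  have cf: "cface F" "dim F = p" if "F \<in> C" for F using that C(1) by (auto simp: stabbed_def)
  have yF: "y F \<in> F" if "F \<in> C" for F using y[OF that] rel_interior_subset by blast
  have yK: "y F \<in> K" if "F \<in> C" for F using yF[OF that] cface_subset[OF cf(1)[OF that]] by blast
  have ay: "0 < a \<bullet> y F" if "F \<in> C" for F using inner_K_pos yK y that by blast
  obtain b where b: "\<And>x. x \<in> K \<Longrightarrow> 0 \<le> b \<bullet> x" "\<And>x. x \<in> K \<Longrightarrow> b \<bullet> x = 0 \<longleftrightarrow> x \<in> F0"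
    by (rule cface_expose[OF F0(1)]) blast
  show "F0 \<in> C"
  proof (rule ccontr)
    assume "F0 \<notin> C"
    have by_pos: "0 < b \<bullet> y F" if "F \<in> C" for F
    proof -
      have "y F \<notin> F0"
        using rel_interior_not_in_cface[OF F0(1) cf(1)[OF that]] \<open>F0 \<notin> C\<close> that cf(2)[OF that] F0(2) y
        by auto
      then show ?thesis using b yK[OF that] by (metis order_le_less)
    qed
    let ?q = "\<lambda>F. (b \<bullet> y F) / (a \<bullet> y F)"
    obtain F where F: "F \<in> C" "\<And>F'. F' \<in> C \<Longrightarrow> ?q F \<le> ?q F'"
      using that[OF arg_min_if_finite(1)[OF fin C(2)] arg_min_least[OF fin C(2)]] .
    define l where "l = ?q F *\<^sub>R a - b"
    have q_pos: "0 < ?q F" using by_pos ay F(1) by simp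
    have lF: "l \<bullet> y F = 0" using ay[OF F(1)] by (simp add: l_def inner_diff_left)
    have l_le: "l \<bullet> y F' \<le> 0" if "F' \<in> C" for F'
      using F(2)[OF that] ay[OF that] by (simp add: l_def inner_diff_left pos_le_divide_eq)
    note cF = cf(1)[OF F(1)]
    have nbF: "\<exists>F'\<in>C. y F' \<in> E \<and> y F' \<notin> F"
      if E: "cface E" "F \<subseteq> E" "dim E = Suc (dim F)" for E
    proof -
      obtain F' where F': "F' \<in> C" "F' \<noteq> F" "F' \<subseteq> E"
        using nb[OF F(1) E(1,2)] E(3) cf(2)[OF F(1)] by auto
      then have "y F' \<notin> F"
        using rel_interior_not_in_cface[OF cF cf(1)[OF F'(1)]] cf(2) F(1) y by simp
      with F' yF show ?thesis by blast
    qed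
    have "\<exists>u\<in>U. \<exists>f\<in>span F. x = u + f" for x
      by (rule complement_of_neighbours[OF cF U(1)]) (use nbF y in blast)
    then have int: "U \<inter> span F = span {y F}"
      using y[OF F(1)] yF[OF F(1)] cf(2)[OF F(1)] U by (intro unique_direction) (auto intro: span_base)
    \<comment> \<open>\<open>l\<close> is known to vanish only along \<open>y F\<close>. Its
      modification \<open>L\<close> vanishes on all of \<open>span F\<close> and agrees with
      \<open>l\<close> on \<open>U\<close>, so the optimality criterion for the whole cone
      applies.\<close>
    obtain L where L: "\<And>x. x \<in> span F \<Longrightarrow> L \<bullet> x = 0" "\<And>u. u \<in> U \<Longrightarrow> L \<bullet> u = l \<bullet> u"
      by (rule extend_functional[OF U(1) subspace_span int lF]) blast
    obtain c where c: "\<And>x. x \<in> K \<Longrightarrow> 0 \<le> c \<bullet> x" "\<And>x. x \<in> K \<Longrightarrow> c \<bullet> x = 0 \<longleftrightarrow> x \<in> F"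
      by (rule cface_expose[OF cF]) blast
    have "L \<bullet> r \<le> 0"
    proof (rule cface_local_opt[OF cF _ _ rK])
      show "L \<bullet> x = 0" if "x \<in> F" for x using that L(1) span_base by blast
    next
      fix E x assume E: "cface E" "F \<subseteq> E" "dim E = Suc (dim F)" and x: "x \<in> E"
      obtain F' where F': "F' \<in> C" "y F' \<in> E" "y F' \<notin> F" using nbF[OF E] by blast
      have "span E = span (insert (y F') F)"
        using span_cface_insert[OF cF E] F' not_in_span_cface[OF cF] yK span_base by blast
      then have "x \<in> span (insert (y F') F)" using x span_base by blast
      \<comment> \<open>Modulo \<open>span F\<close> the point \<open>x\<close> is \<open>k\<close>
        times \<open>y F'\<close>. As \<open>c\<close> exposes \<open>F\<close>, it shows that
        \<open>k\<close> is nonnegative, and the bound at \<open>y F'\<close> carries over to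
        \<open>E\<close>.\<close>
      then obtain k where k: "x - k *\<^sub>R y F' \<in> span F" by (auto simp: span_breakdown_eq)
      have "c \<bullet> (x - k *\<^sub>R y F') = 0"
        by (rule inner_zero_on_span[OF _ k]) (use c(2) cface_subset[OF cF] in blast)
      moreover have "0 \<le> c \<bullet> x" using c(1) x cface_subset[OF E(1)] by blast
      moreover have "0 < c \<bullet> y F'" using c F' yK by (metis order_le_less)
      ultimately have "0 \<le> k" by (simp add: inner_diff_right zero_le_mult_iff)
      moreover have "L \<bullet> x = k * (l \<bullet> y F')"
        using L(1)[OF k] L(2) y[OF F'(1)] by (simp add: inner_diff_right)
      ultimately show "L \<bullet> x \<le> 0" using l_le[OF F'(1)] by (simp add: mult_nonneg_nonpos)
    qed
    moreover have "L \<bullet> r = ?q F * (a \<bullet> r)"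
      using L(2)[OF r(1)] b(2)[OF rK] rF0 by (simp add: l_def inner_diff_left)
    moreover have "0 < a \<bullet> r" using inner_K_pos[OF rK r(3)] .
    ultimately show False using q_pos by (metis mult_pos_pos not_less)
  qed
qed

end

section \<open>Coordinates modulo a facet and directions inside a slice\<close>

context pointed_polycone
begin

text \<open>The apex is a face, exposed by \<open>a\<close>, and a proper face of a polyhedron lies
  in a facet.\<close>

lemma cface_has_facet:
  assumes "cface F" "dim F = Suc m"
  obtains G where "cface G" "G \<subseteq> F" "dim G = m"
proof -
  have "K \<inter> {x. a \<bullet> x = 0} face_of K"
    by (rule face_of_Int_supporting_hyperplane_ge[OF convex_K])
      (use inner_K_pos in \<open>force simp: order_le_less\<close>)
  also have "K \<inter> {x. a \<bullet> x = 0} = {0}"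
    using inner_K_pos zero_in_K by force
  finally have "cface {0}" by (simp add: cface_def)
  then have "{0} face_of F" using cface_face_of assms(1) cface_zero by blast
  moreover have "{0} \<noteq> F" using assms(2) by force
  ultimately obtain G where "G facet_of F"
    using face_of_polyhedron_subset_facet[OF cface_polyhedron[OF assms(1)]] by blast
  from cface_facet[OF assms(1) this] assms(2) show ?thesis using that by simp
qed

text \<open>\<open>s\<close> is the coordinate of \<open>z\<close> in the one-dimensional quotient
  of \<open>span F\<close> by \<open>span G\<close>. A functional exposing \<open>G\<close> reads it
  off, so its sign tells on which side of \<open>G\<close> the point lies.\<close>

lemma facet_coordinate:
  assumes F: "cface F" and G: "cface G" "G \<subseteq> F" "dim F = Suc (dim G)"
    and y: "y \<in> F" "y \<notin> G" and z: "z \<in> span F"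
  obtains s where "z - s *\<^sub>R y \<in> span G"
    "z \<in> K \<Longrightarrow> z \<notin> G \<Longrightarrow> 0 < s" "\<exists>b. (\<forall>x\<in>G. b \<bullet> x = 0) \<and> 0 < b \<bullet> y \<and> b \<bullet> z = s * (b \<bullet> y)"
proof -
  have yK: "y \<in> K" using y(1) cface_subset[OF F] by blast
  then have "span F = span (insert y G)"
    using span_cface_insert[OF G(1) F G(2,3)] y span_base not_in_span_cface[OF G(1)] by blast
  then obtain s where s: "z - s *\<^sub>R y \<in> span G" using z by (auto simp: span_breakdown_eq)
  obtain b where b: "\<And>x. x \<in> K \<Longrightarrow> 0 \<le> b \<bullet> x" "\<And>x. x \<in> K \<Longrightarrow> b \<bullet> x = 0 \<longleftrightarrow> x \<in> G"
    by (rule cface_expose[OF G(1)]) blast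
  have bG: "b \<bullet> x = 0" if "x \<in> G" for x using that b(2) cface_subset[OF G(1)] by blast
  have by_pos: "0 < b \<bullet> y" using b[OF yK] y(2) by simp
  have bz: "b \<bullet> z = s * (b \<bullet> y)"
    using inner_zero_on_span[OF bG s] by (simp add: inner_diff_right)
  show ?thesis
  proof (rule that[OF s])
    assume "z \<in> K" "z \<notin> G"
    then have "0 < b \<bullet> z" using b[of z] by simp
    then show "0 < s" using bz by_pos by (simp add: zero_less_mult_iff)
  qed (use bG by_pos bz in blast)
qed

lemma rel_interior_not_in_facet:
  assumes "cface F" "cface G" "G \<subseteq> F" "dim F = Suc (dim G)" "x \<in> rel_interior F"
  shows "x \<notin> G"
  using assms face_of_disjoint_rel_interior[OF cface_face_of[OF assms(2,1,3)]] by force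

lemma exit_direction:
  assumes X: "subspace X" "y \<in> X" "y \<in> K" "y \<noteq> 0" "d \<in> X" "d \<notin> span {y}"
  obtains s where "d - s *\<^sub>R y \<in> X" "d - s *\<^sub>R y \<noteq> 0" "a \<bullet> (d - s *\<^sub>R y) = 0"
proof -
  have "0 < a \<bullet> y" using inner_K_pos X by blast
  then show ?thesis
    using X by (intro that[of "(a \<bullet> d) / (a \<bullet> y)"])
      (auto simp: inner_diff_right subspace_diff subspace_scale span_singleton)
qed

lemma dim_Int_ge:
  fixes U X :: "'a set"
  assumes "subspace U" "subspace X"
  shows "dim U + dim X \<le> DIM('a) + dim (U \<inter> X)"
  using dim_sums_Int[OF assms] dim_subset_UNIV[of "{x + y |x y. x \<in> U \<and> y \<in> X}"] by simp

lemma dim_ge_2_not_line: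
  fixes y :: 'a
  assumes "2 \<le> dim X"
  obtains d where "d \<in> X" "d \<notin> span {y}"
proof -
  have "\<not> X \<subseteq> span {y}"
  proof
    assume "X \<subseteq> span {y}"
    then have "dim X \<le> dim {y}" by (rule dim_mono)
    then show False using assms by (simp split: if_splits)
  qed
  then show ?thesis using that by blast
qed

end

section \<open>Generic subspaces: vertices and edges of the section\<close>

text \<open>Throughout, \<open>p = n - k + 1\<close> is the dimension of the cone over an \<open>(n-k)\<close>-dimensional face.\<close>

locale generic_subspace = pointed_polycone +
  fixes V :: "'a set" and p :: nat
  assumes V: "subspace V" and dim_V: "dim V + p = Suc DIM('a)"
    and generic: "\<And>G x. cface G \<Longrightarrow> dim G < p \<Longrightarrow> x \<in> V \<Longrightarrow> x \<in> G \<Longrightarrow> x = 0"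
begin

text \<open>A point on the relative boundary would lie in a face of dimension below
  \<open>p\<close>, against genericity.\<close>

lemma stabbedI:
  assumes "cface H" "dim H = p" "x \<in> V" "x \<in> H" "x \<noteq> 0"
  shows "H \<in> stabbed p V"
proof -
  have "x \<in> rel_interior H"
  proof (rule ccontr)
    assume "x \<notin> rel_interior H"
    then obtain G where "cface G" "G \<subseteq> H" "x \<in> G" "dim H = Suc (dim G)"
      by (rule cface_boundary[OF assms(1,4)])
    then show False using generic[of G x] assms by simp
  qed
  then show ?thesis using assms by (auto simp: stabbed_def)
qed

lemma boundary_point:
  assumes H: "cface H" and y: "y \<in> V" "y \<in> H" "y \<noteq> 0"
    and d: "d \<in> V" "d \<in> span H" "d \<noteq> 0" "a \<bullet> d = 0"
  obtains G t where "cface G" "G \<subseteq> H" "dim H = Suc (dim G)" "0 \<le> t"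
    "y + t *\<^sub>R d \<in> V" "y + t *\<^sub>R d \<in> G" "y + t *\<^sub>R d \<noteq> 0"
    "\<And>s. 0 \<le> s \<Longrightarrow> y + s *\<^sub>R d \<in> H \<Longrightarrow> s \<le> t"
proof -
  obtain t where t: "0 \<le> t" "y + t *\<^sub>R d \<in> H" "y + t *\<^sub>R d \<notin> rel_interior H"
    "\<And>s. 0 \<le> s \<Longrightarrow> y + s *\<^sub>R d \<in> H \<Longrightarrow> s \<le> t"
    by (rule cface_exit[OF H y(2) d(2-4)]) blast
  obtain G where G: "cface G" "G \<subseteq> H" "y + t *\<^sub>R d \<in> G" "dim H = Suc (dim G)"
    by (rule cface_boundary[OF H t(2,3)]) blast
  have "0 < a \<bullet> y" using inner_K_pos y cface_subset[OF H] by blast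
  then have "0 < a \<bullet> (y + t *\<^sub>R d)" using d(4) by (simp add: inner_add_right)
  then have "y + t *\<^sub>R d \<noteq> 0" by auto
  moreover have "y + t *\<^sub>R d \<in> V" using y d V by (simp add: subspace_add subspace_scale)
  ultimately show ?thesis using that G t by blast
qed

text \<open>In a face of dimension above \<open>p\<close>, \<open>V\<close> meets the span in
  dimension at least 2. This leaves a direction in the slice along which to move until a facet is
  reached; the descent stops at dimension \<open>p\<close>.\<close>

lemma stabbed_nonempty:
  assumes "cface H" "x \<in> V" "x \<in> H" "x \<noteq> 0"
  shows "stabbed p V \<noteq> {}"
  using assms
proof (induction "dim H" arbitrary: H x rule: less_induct)
  case less
  consider "dim H < p" | "dim H = p" | "p < dim H" by linarith
  then show ?case
  proof cases
    case 1
    then show ?thesis using generic less.prems by blast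
  next
    case 2
    then show ?thesis using stabbedI less.prems by blast
  next
    case 3
    let ?X = "V \<inter> span H"
    have "2 \<le> dim ?X" using 3 dim_Int_ge[OF V subspace_span, of H] dim_V by simp
    then obtain d where "d \<in> ?X" "d \<notin> span {x}" by (rule dim_ge_2_not_line)
    moreover have "x \<in> ?X" "x \<in> K" using less.prems span_base cface_subset by blast+
    ultimately obtain s where s: "d - s *\<^sub>R x \<in> ?X" "d - s *\<^sub>R x \<noteq> 0" "a \<bullet> (d - s *\<^sub>R x) = 0"
      using exit_direction[of ?X x d] less.prems(4) V subspace_inter subspace_span by blast
    obtain G t where "cface G" "dim H = Suc (dim G)"
      "x + t *\<^sub>R (d - s *\<^sub>R x) \<in> V" "x + t *\<^sub>R (d - s *\<^sub>R x) \<in> G" "x + t *\<^sub>R (d - s *\<^sub>R x) \<noteq> 0"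
      by (rule boundary_point[OF less.prems, of "d - s *\<^sub>R x"]) (use s in auto)
    then show ?thesis using less.hyps[of G] by simp
  qed
qed

text \<open>A second direction would lead from \<open>y\<close> to a facet of \<open>F\<close>,
  whose dimension is below \<open>p\<close>.\<close>

lemma stabbed_Int_span:
  assumes F: "cface F" "dim F = p" and y: "y \<in> V" "y \<in> F" "y \<noteq> 0"
  shows "V \<inter> span F \<subseteq> span {y}"
proof
  fix d assume d: "d \<in> V \<inter> span F"
  show "d \<in> span {y}"
  proof (rule ccontr)
    assume "d \<notin> span {y}"
    moreover have "y \<in> V \<inter> span F" "y \<in> K" using F(1) y span_base cface_subset by blast+
    ultimately obtain s where s: "d - s *\<^sub>R y \<in> V \<inter> span F" "d - s *\<^sub>R y \<noteq> 0" "a \<bullet> (d - s *\<^sub>R y) = 0"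
      using exit_direction[of "V \<inter> span F" y d] y d V subspace_inter subspace_span by blast
    obtain G t where "cface G" "dim F = Suc (dim G)"
      "y + t *\<^sub>R (d - s *\<^sub>R y) \<in> V" "y + t *\<^sub>R (d - s *\<^sub>R y) \<in> G" "y + t *\<^sub>R (d - s *\<^sub>R y) \<noteq> 0"
      by (rule boundary_point[OF F(1) y, of "d - s *\<^sub>R y"]) (use s in auto)
    then show False using generic[of G] F(2) by auto
  qed
qed

text \<open>An edge of the section starts at the vertex \<open>y\<close> and ends at another vertex:
  a direction of \<open>V\<close> pointing from \<open>F\<close> into \<open>E\<close> leaves
  \<open>E\<close> through a facet other than \<open>F\<close>.\<close>

lemma stabbed_neighbour:
  assumes F: "F \<in> stabbed p V" and E: "cface E" "F \<subseteq> E" "dim E = Suc p"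
  shows "\<exists>F'\<in>stabbed p V. F' \<noteq> F \<and> F' \<subseteq> E"
proof -
  obtain y where cF: "cface F" "dim F = p" and y: "y \<in> V" "y \<in> rel_interior F" "y \<noteq> 0"
    using F by (auto simp: stabbed_def)
  have yF: "y \<in> F" using y(2) rel_interior_subset by blast
  have yE: "y \<in> E" "y \<in> span E" "y \<in> K" using yF E span_base cface_subset by blast+
  have "2 \<le> dim (V \<inter> span E)" using E(3) dim_Int_ge[OF V subspace_span, of E] dim_V by simp
  then obtain d0 where d0: "d0 \<in> V \<inter> span E" "d0 \<notin> span {y}" by (rule dim_ge_2_not_line)
  then have d0F: "d0 \<notin> span F" using stabbed_Int_span[OF cF y(1) yF y(3)] by blast
  have dE: "dim E = Suc (dim F)" using E(3) cF(2) by simp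
  obtain b where b: "\<And>x. x \<in> K \<Longrightarrow> 0 \<le> b \<bullet> x" "\<And>x. x \<in> K \<Longrightarrow> b \<bullet> x = 0 \<longleftrightarrow> x \<in> F"
    by (rule cface_expose[OF cF(1)]) blast
  have bF: "b \<bullet> x = 0" if "x \<in> span F" for x
    by (rule inner_zero_on_span[OF _ that]) (use b(2) cface_subset[OF cF(1)] in blast)
  obtain e where e: "e \<in> E" "e \<notin> F" using E(2) dE by (metis n_not_Suc_n subsetI subset_antisym)
  have eK: "e \<in> K" using e(1) cface_subset[OF E(1)] by blast
  have be: "0 < b \<bullet> e" using b[OF eK] e(2) by auto
  have "span E = span (insert e F)"
    using e eK not_in_span_cface[OF cF(1)] span_cface_insert[OF cF(1) E(1,2) dE] span_base by blast
  then have decomp: "\<exists>k. x - k *\<^sub>R e \<in> span F" if "x \<in> span E" for x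
    using that by (simp add: span_breakdown_eq)
  have "b \<bullet> d0 \<noteq> 0"
  proof
    assume "b \<bullet> d0 = 0"
    obtain k where k: "d0 - k *\<^sub>R e \<in> span F" using decomp d0 by blast
    then have "k = 0" using bF[OF k] \<open>b \<bullet> d0 = 0\<close> be by (simp add: inner_diff_right)
    with k d0F show False by simp
  qed
  \<comment> \<open>The sign makes the direction point to the side of \<open>F\<close> on which
    \<open>E\<close> lies.\<close>
  define d1 where "d1 = sgn (b \<bullet> d0) *\<^sub>R d0"
  have d1: "d1 \<in> V \<inter> span E" "0 < b \<bullet> d1"
    using d0(1) V \<open>b \<bullet> d0 \<noteq> 0\<close> by (auto simp: d1_def subspace_scale span_scale sgn_if)
  have "d1 \<notin> span {y}"
  proof
    assume "d1 \<in> span {y}"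
    then have "b \<bullet> d1 = 0" using bF[OF span_base[OF yF]] by (auto simp: span_singleton)
    with d1(2) show False by simp
  qed
  then obtain s where s: "d1 - s *\<^sub>R y \<in> V \<inter> span E" "d1 - s *\<^sub>R y \<noteq> 0" "a \<bullet> (d1 - s *\<^sub>R y) = 0"
    using exit_direction[of "V \<inter> span E" y d1] yE y d1(1) V subspace_inter subspace_span by blast
  define d where "d = d1 - s *\<^sub>R y"
  have bd: "0 < b \<bullet> d" using d1(2) bF[OF span_base[OF yF]] by (simp add: d_def inner_diff_right)
  \<comment> \<open>A short step along the \<open>span F\<close> part of \<open>d\<close> stays in
    \<open>F\<close>, and adding a positive multiple of \<open>e\<close> stays in \<open>E\<close>.
    Hence \<open>d\<close> really enters \<open>E\<close> and the exit parameter is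
    positive.\<close>
  obtain k where k: "d - k *\<^sub>R e \<in> span F" using decomp s(1) unfolding d_def by blast
  have "0 < k" using bF[OF k] bd be by (simp add: inner_diff_right zero_less_mult_iff)
  obtain \<epsilon> where \<epsilon>: "0 < \<epsilon>" "y + \<epsilon> *\<^sub>R (d - k *\<^sub>R e) \<in> F"
    by (rule rel_interior_move[OF cF(1) y(2) k]) blast
  have "y + \<epsilon> *\<^sub>R (d - k *\<^sub>R e) + (\<epsilon> * k) *\<^sub>R e \<in> E"
    by (rule convex_cone_add[OF cface_convex_cone[OF E(1)] _ convex_cone_scaleR[OF cface_convex_cone[OF E(1)]]])
      (use \<epsilon> \<open>0 < k\<close> e(1) E(2) in auto)
  then have step: "y + \<epsilon> *\<^sub>R d \<in> E" by (simp add: algebra_simps)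
  obtain G t where G: "cface G" "G \<subseteq> E" "dim E = Suc (dim G)"
    and t: "y + t *\<^sub>R d \<in> V" "y + t *\<^sub>R d \<in> G" "y + t *\<^sub>R d \<noteq> 0"
      "\<And>s. 0 \<le> s \<Longrightarrow> y + s *\<^sub>R d \<in> E \<Longrightarrow> s \<le> t"
    by (rule boundary_point[OF E(1) y(1) yE(1) y(3), of d]) (use s in \<open>auto simp: d_def\<close>)
  have "0 < t" using t(4)[of \<epsilon>] \<epsilon>(1) step by simp
  have "y + t *\<^sub>R d \<notin> F"
  proof
    assume "y + t *\<^sub>R d \<in> F"
    then have "b \<bullet> (y + t *\<^sub>R d) = 0" using bF span_base by blast
    then show False
      using bF[OF span_base[OF yF]] \<open>0 < t\<close> bd by (simp add: inner_add_right)
  qed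
  moreover have "G \<in> stabbed p V" using stabbedI[OF G(1) _ t(1,2,3)] G(3) E(3) by simp
  ultimately show ?thesis using t(2) G(2) by blast
qed

end

section \<open>Sign patterns of Chow forms\<close>

locale chow_cone = full_pointed_polycone S a + generic_subspace S a V "Suc m"
  for S :: "'a::euclidean_space set" and a V m +
  fixes M :: "'a set \<Rightarrow> nat \<Rightarrow> 'a" and A :: "nat \<Rightarrow> 'a"
  assumes M_mem: "\<And>G i. cface G \<Longrightarrow> dim G = m \<Longrightarrow> i < m \<Longrightarrow> M G i \<in> G"
    and M_inj: "\<And>G. cface G \<Longrightarrow> dim G = m \<Longrightarrow> inj_on (M G) {..<m}"
    and M_indep: "\<And>G. cface G \<Longrightarrow> dim G = m \<Longrightarrow> independent (M G ` {..<m})"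
    and V_eq: "V = {x. \<forall>j<m. A j \<bullet> x = 0}"
begin

definition support :: "'a set set" where
  "support = {G. cface G \<and> dim G = m \<and> (\<exists>F\<in>stabbed (Suc m) V. G \<subseteq> F)}"

lemma span_M:
  assumes "cface G" "dim G = m"
  shows "span (M G ` {..<m}) = span G"
proof -
  have "dim (M G ` {..<m}) = m"
    using M_indep[OF assms] M_inj[OF assms] by (simp add: dim_eq_card_independent card_image)
  then show ?thesis
    using M_mem[OF assms] assms(2) by (intro dim_eq_span) auto
qed

text \<open>The kernel of \<open>C\<close> meets \<open>span F\<close> at most in the line of
  \<open>y\<close>, and this line meets \<open>span G\<close> only in 0.\<close>

lemma pair_det_M_nonzero:
  assumes F: "cface F" and G: "cface G" "G \<subseteq> F" "dim G = m"
    and y: "y \<in> F" "y \<notin> G" and line: "{x. \<forall>j<m. C j \<bullet> x = 0} \<inter> span F \<subseteq> span {y}"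
  shows "pair_det m (M G) C \<noteq> 0"
proof (rule pair_det_nonzero[OF M_inj[OF G(1,3)] M_indep[OF G(1,3)]])
  fix x assume x: "x \<in> span (M G ` {..<m})" "\<And>j. j < m \<Longrightarrow> C j \<bullet> x = 0"
  then have xG: "x \<in> span G" by (simp add: span_M[OF G(1,3)])
  then have "x \<in> span {y}" using x(2) line span_mono[OF G(2)] by blast
  then obtain c where c: "x = c *\<^sub>R y" by (auto simp: span_singleton)
  have "y \<notin> span G" using y cface_subset[OF F] not_in_span_cface[OF G(1)] by blast
  then show "x = 0"
    using xG c span_scale[of "c *\<^sub>R y" G "inverse c"] by (cases "c = 0") auto
qed

lemma stabbed_line:
  assumes U: "subspace U" "dim U + Suc m = Suc DIM('a)"
    and sub: "stabbed (Suc m) V \<subseteq> stabbed (Suc m) U" and F: "F \<in> stabbed (Suc m) V"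
  obtains z where "z \<in> U" "z \<in> rel_interior F" "z \<noteq> 0" "U \<inter> span F = span {z}"
proof -
  obtain z where cF: "cface F" "dim F = Suc m" and z: "z \<in> U" "z \<in> rel_interior F" "z \<noteq> 0"
    using F sub by (force simp: stabbed_def)
  have "\<exists>u\<in>U. u \<in> E \<and> u \<notin> F" if E: "cface E" "F \<subseteq> E" "dim E = Suc (dim F)" for E
  proof -
    obtain F' where F': "F' \<in> stabbed (Suc m) V" "F' \<noteq> F" "F' \<subseteq> E"
      using stabbed_neighbour[OF F E(1,2)] E(3) cF(2) by auto
    then have "F' \<in> stabbed (Suc m) U" using sub by blast
    then obtain u where "cface F'" "dim F' = Suc m" "u \<in> U" "u \<in> rel_interior F'"
      by (auto simp: stabbed_def)
    then show ?thesis
      using rel_interior_not_in_cface[OF cF(1)] F' cF(2) rel_interior_subset by (metis le_refl subsetD)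
  qed
  then have "\<exists>u\<in>U. \<exists>f\<in>span F. x = u + f" for x
    by (rule complement_of_neighbours[OF cF(1) U(1)])
  then have "U \<inter> span F = span {z}"
    using z U cF(2) rel_interior_subset[of F] by (intro unique_direction) (auto intro: span_base)
  with z show ?thesis using that by blast
qed

lemma sgn_adjacent:
  assumes U: "U = {x. \<forall>j<m. B j \<bullet> x = 0}"
    and E: "cface E" "dim E = Suc (Suc m)"
    and F: "cface F" "F \<subseteq> E" "dim F = Suc m" and F': "cface F'" "F' \<subseteq> E" "dim F' = Suc m"
    and ne: "F' \<noteq> F"
    and G: "cface G" "G \<subseteq> F" "dim G = m" and G': "cface G'" "G' \<subseteq> F'" "dim G' = m"
    and y: "y \<in> V" "y \<in> rel_interior F" and y': "y' \<in> V" "y' \<in> rel_interior F'"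
    and z: "z \<in> U" "z \<in> rel_interior F" and z': "z' \<in> U" "z' \<in> rel_interior F'"
  shows "sgn (pair_det m (M G) A * pair_det m (M G') B) = sgn (pair_det m (M G') A * pair_det m (M G) B)"
proof -
  have memF: "y \<in> F" "z \<in> F" "y' \<in> F'" "z' \<in> F'"
    using y z y' z' rel_interior_subset by blast+
  have notG: "y \<notin> G" "z \<notin> G"
    using rel_interior_not_in_facet[OF F(1) G(1,2)] F(3) G(3) y z by auto
  have notG': "y' \<notin> G'" "z' \<notin> G'"
    using rel_interior_not_in_facet[OF F'(1) G'(1,2)] F'(3) G'(3) y' z' by auto
  have notF: "y' \<notin> F" "z' \<notin> F"
    using rel_interior_not_in_cface[OF F(1) F'(1) ne] F(3) F'(3) y' z' by auto
  have notF': "y \<notin> F'" "z \<notin> F'"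
    using rel_interior_not_in_cface[OF F'(1) F(1) ne[symmetric]] F(3) F'(3) y z by auto
  have K: "y \<in> K" "z \<in> K" "y' \<in> K" "z' \<in> K"
    using memF cface_subset[OF F(1)] cface_subset[OF F'(1)] by blast+
  have dE: "dim E = Suc (dim F)" "dim E = Suc (dim F')" using E F F' by auto
  have dF: "dim F = Suc (dim G)" "dim F' = Suc (dim G')" using G F F' G' by auto
  \<comment> \<open>The four coordinates compare \<open>z\<close> with \<open>y\<close> modulo
    \<open>G\<close> and modulo \<open>F'\<close>, and \<open>z'\<close> with \<open>y'\<close>
    modulo \<open>G'\<close> and modulo \<open>F\<close>. All are positive because the points lie in
    the cone and off the face in question.\<close>
  obtain s where s: "z - s *\<^sub>R y \<in> span G" "0 < s"
    by (rule facet_coordinate[OF F(1) G(1,2) dF(1) memF(1) notG(1) span_base[OF memF(2)]])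
      (use K notG in blast)
  obtain t' where t': "z' - t' *\<^sub>R y' \<in> span G'" "0 < t'"
    by (rule facet_coordinate[OF F'(1) G'(1,2) dF(2) memF(3) notG'(1) span_base[OF memF(4)]])
      (use K notG' in blast)
  have memE: "y \<in> E" "z \<in> E" "y' \<in> E" "z' \<in> E" using memF F F' by blast+
  obtain s' where s': "z' - s' *\<^sub>R y' \<in> span F" "0 < s'"
    by (rule facet_coordinate[OF E(1) F(1,2) dE(1) memE(3) notF(1) span_base[OF memE(4)]])
      (use K notF in blast)
  obtain t where t: "z - t *\<^sub>R y \<in> span F'" "0 < t"
    by (rule facet_coordinate[OF E(1) F'(1,2) dE(2) memE(1) notF'(1) span_base[OF memE(2)]])
      (use K notF' in blast)
  obtain b where b: "\<And>x. x \<in> K \<Longrightarrow> 0 \<le> b \<bullet> x" "\<And>x. x \<in> K \<Longrightarrow> b \<bullet> x = 0 \<longleftrightarrow> x \<in> F"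
    by (rule cface_expose[OF F(1)]) blast
  have spanF: "span F = span (insert y (M G ` {..<m}))"
  proof -
    have "span F = span (insert y G)"
      using span_cface_insert[OF G(1) F(1) G(2) dF(1)] span_base[OF memF(1)]
        not_in_span_cface[OF G(1) K(1) notG(1)] by simp
    then show ?thesis by (simp add: span_insert span_M[OF G(1,3)])
  qed
  have spanF': "span F' = span (insert y' (M G' ` {..<m}))"
  proof -
    have "span F' = span (insert y' G')"
      using span_cface_insert[OF G'(1) F'(1) G'(2) dF(2)] span_base[OF memF(3)]
        not_in_span_cface[OF G'(1) K(3) notG'(1)] by simp
    then show ?thesis by (simp add: span_insert span_M[OF G'(1,3)])
  qed
  have nz: "y \<noteq> 0" "z \<noteq> 0" using notG cface_zero[OF G(1)] by auto
  show ?thesis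
  proof (rule pair_det_sgn_adjacent[where X = "span E" and b = b and a = a and y = y and y' = y'
        and z = z and z' = z' and s = s and s' = s' and t = t and t' = t'])
    show "M G i \<in> span E" if "i < m" for i
      using M_mem[OF G(1,3) that] G(2) F(2) span_base by blast
    show "M G' i \<in> span E" if "i < m" for i
      using M_mem[OF G'(1,3) that] G'(2) F'(2) span_base by blast
  qed (use E memE y y' z z' U V_eq b K notF memF nz s s' t t' spanF spanF' inner_K_pos
      span_M[OF G(1,3)] span_M[OF G'(1,3)] in \<open>auto intro: span_base simp: order_less_le\<close>)
qed

lemma pair_det_ratio_same_face:
  assumes U: "U = {x. \<forall>j<m. B j \<bullet> x = 0}"
    and F: "cface F" "dim F = Suc m"
    and G: "cface G" "G \<subseteq> F" "dim G = m" and G': "cface G'" "G' \<subseteq> F" "dim G' = m"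
    and y: "y \<in> V" "y \<in> F" "y \<noteq> 0" and z: "z \<in> U" "z \<noteq> 0"
    and s: "z - s *\<^sub>R y \<in> span G" and t: "z - t *\<^sub>R y \<in> span G'"
  shows "pair_det m (M G) A * pair_det m (M G') B * s = pair_det m (M G') A * pair_det m (M G) B * t"
proof (rule pair_det_ratio_facets[where X = "span F" and y = y and z = z])
  show "M G i \<in> span F" if "i < m" for i using M_mem[OF G(1,3) that] G(2) span_base by blast
  show "M G' i \<in> span F" if "i < m" for i using M_mem[OF G'(1,3) that] G'(2) span_base by blast
qed (use F y z s t U V_eq span_M[OF G(1,3)] span_M[OF G'(1,3)] in \<open>auto intro: span_base\<close>)

text \<open>One facet fixes the global sign. \<open>pair_det_ratio_same_face\<close> spreads it over
  the facets of one stabbed face, \<open>sgn_adjacent\<close> to neighbouring stabbed faces, and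
  \<open>stabbed_subset_if_closed\<close> to all of them.\<close>

lemma sgn_pattern_if_stabbed:
  assumes U: "subspace U" "dim U + Suc m = Suc DIM('a)" "U = {x. \<forall>j<m. B j \<bullet> x = 0}"
    and sub: "stabbed (Suc m) V \<subseteq> stabbed (Suc m) U"
  shows "\<exists>\<sigma>\<in>{1, -1}. \<forall>G\<in>support. sgn (pair_det m (M G) B) = \<sigma> * sgn (pair_det m (M G) A)"
proof (cases "support = {}")
  case False
  let ?S = "stabbed (Suc m) V"
  let ?A = "\<lambda>G. pair_det m (M G) A" and ?B = "\<lambda>G. pair_det m (M G) B"
  have cf: "cface F" "dim F = Suc m" if "F \<in> ?S" for F using that by (auto simp: stabbed_def)
  have "\<exists>y. y \<in> V \<and> y \<in> rel_interior F \<and> y \<noteq> 0 \<and> V \<inter> span F = span {y}" if "F \<in> ?S" for F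
    by (rule stabbed_line[OF V dim_V subset_refl that]) blast
  then obtain y where y: "\<And>F. F \<in> ?S \<Longrightarrow> y F \<in> V \<and> y F \<in> rel_interior F \<and> y F \<noteq> 0
      \<and> V \<inter> span F = span {y F}" by metis
  have "\<exists>z. z \<in> U \<and> z \<in> rel_interior F \<and> z \<noteq> 0 \<and> U \<inter> span F = span {z}" if "F \<in> ?S" for F
    by (rule stabbed_line[OF U(1,2) sub that]) blast
  then obtain z where z: "\<And>F. F \<in> ?S \<Longrightarrow> z F \<in> U \<and> z F \<in> rel_interior F \<and> z F \<noteq> 0
      \<and> U \<inter> span F = span {z F}" by metis
  have nz: "?A G \<noteq> 0 \<and> ?B G \<noteq> 0" if F: "F \<in> ?S" and G: "cface G" "G \<subseteq> F" "dim G = m" for F G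
  proof -
    have "y F \<in> F" "z F \<in> F" using y[OF F] z[OF F] rel_interior_subset by blast+
    moreover have "y F \<notin> G" "z F \<notin> G"
      using rel_interior_not_in_facet[OF cf(1)[OF F] G(1,2)] cf(2)[OF F] G(3) y[OF F] z[OF F] by auto
    moreover have "{x. \<forall>j<m. A j \<bullet> x = 0} \<inter> span F \<subseteq> span {y F}"
      "{x. \<forall>j<m. B j \<bullet> x = 0} \<inter> span F \<subseteq> span {z F}"
      using y[OF F] z[OF F] V_eq U(3) by simp_all
    ultimately show ?thesis
      using pair_det_M_nonzero[OF cf(1)[OF F] G] by blast
  qed
  obtain G0 F0 where F0: "F0 \<in> ?S" and G0: "cface G0" "G0 \<subseteq> F0" "dim G0 = m"
    using False by (auto simp: support_def)
  define \<sigma> where "\<sigma> = sgn (?A G0) * sgn (?B G0)"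
  have \<sigma>: "\<sigma> \<in> {1, -1}" using nz[OF F0 G0] by (auto simp: \<sigma>_def sgn_if)
  define good where "good G \<longleftrightarrow> sgn (?B G) = \<sigma> * sgn (?A G)" for G
  have good0: "good G0" using nz[OF F0 G0] by (auto simp: good_def \<sigma>_def sgn_if)
  have transfer: "good G'"
    if "good G" and eq: "sgn (?A G * ?B G') = sgn (?A G' * ?B G)" and n: "?A G \<noteq> 0" for G G'
  proof -
    have "sgn (?A G) * sgn (?B G') = sgn (?A G) * (\<sigma> * sgn (?A G'))"
      using eq \<open>good G\<close> by (simp add: good_def sgn_mult mult_ac)
    then show ?thesis using n by (simp add: good_def sgn_zero_iff)
  qed
  define C where "C = {F \<in> ?S. \<forall>G. cface G \<longrightarrow> G \<subseteq> F \<longrightarrow> dim G = m \<longrightarrow> good G}"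
  have "F0 \<in> C"
  proof -
    have "good G" if G: "cface G" "G \<subseteq> F0" "dim G = m" for G
    proof (rule transfer[OF good0 _ conjunct1[OF nz[OF F0 G0]]])
      note c = cf[OF F0]
      have mem: "y F0 \<in> F0" "z F0 \<in> F0" using y[OF F0] z[OF F0] rel_interior_subset by blast+
      have K: "z F0 \<in> K" using mem cface_subset[OF c(1)] by blast
      have ni: "y F0 \<notin> H" "z F0 \<notin> H" if "cface H" "H \<subseteq> F0" "dim H = m" for H
        using rel_interior_not_in_facet[OF c(1) that(1,2)] that(3) c(2) y[OF F0] z[OF F0] by auto
      have "\<exists>s>0. z F0 - s *\<^sub>R y F0 \<in> span H" if H: "cface H" "H \<subseteq> F0" "dim H = m" for H
      proof -
        have "dim F0 = Suc (dim H)" using H(3) c(2) by simp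
        then show ?thesis
          by (rule facet_coordinate[OF c(1) H(1,2) _ mem(1) ni(1)[OF H] span_base[OF mem(2)]])
            (use K ni(2)[OF H] in blast)
      qed
      \<comment> \<open>Both intersection points are interior to \<open>F0\<close>, so the two
        coordinates are positive and do not affect the signs.\<close>
      from this[OF G0] this[OF G] obtain s t where st: "0 < s" "z F0 - s *\<^sub>R y F0 \<in> span G0" "0 < t" "z F0 - t *\<^sub>R y F0 \<in> span G"
        by blast
      have "?A G0 * ?B G * s = ?A G * ?B G0 * t"
        using pair_det_ratio_same_face[OF U(3) c G0 G _ mem(1) _ _ _ st(2,4)] y[OF F0] z[OF F0] by blast
      then have "sgn (?A G0 * ?B G * s) = sgn (?A G * ?B G0 * t)" by simp
      then show "sgn (?A G0 * ?B G) = sgn (?A G * ?B G0)" using st by (simp add: sgn_mult)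
    qed
    then show ?thesis using F0 by (simp add: C_def)
  qed
  have "?S \<subseteq> C"
  proof (rule stabbed_subset_if_closed[OF V dim_V])
    show "C \<subseteq> ?S" by (auto simp: C_def)
    show "C \<noteq> {}" using \<open>F0 \<in> C\<close> by blast
    fix F E assume "F \<in> C" and E: "cface E" "F \<subseteq> E" "dim E = Suc (Suc m)"
    then have F: "F \<in> ?S" "\<And>G. cface G \<Longrightarrow> G \<subseteq> F \<Longrightarrow> dim G = m \<Longrightarrow> good G" by (auto simp: C_def)
    obtain F' where F': "F' \<in> ?S" "F' \<noteq> F" "F' \<subseteq> E" using stabbed_neighbour[OF F(1) E] by blast
    obtain G where G: "cface G" "G \<subseteq> F" "dim G = m" by (rule cface_has_facet[OF cf[OF F(1)]])
    have "good G'" if G': "cface G'" "G' \<subseteq> F'" "dim G' = m" for G'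
    proof (rule transfer[OF F(2)[OF G] _ conjunct1[OF nz[OF F(1) G]]])
      show "sgn (?A G * ?B G') = sgn (?A G' * ?B G)"
        using y[OF F(1)] z[OF F(1)] y[OF F'(1)] z[OF F'(1)]
        by (intro sgn_adjacent[OF U(3) E(1,3) cf(1)[OF F(1)] E(2) cf(2)[OF F(1)]
              cf(1)[OF F'(1)] F'(3) cf(2)[OF F'(1)] F'(2) G G', of "y F" "y F'" "z F" "z F'"]) auto
    qed
    then have "F' \<in> C" using F'(1) by (simp add: C_def)
    then show "\<exists>F'\<in>C. F' \<noteq> F \<and> F' \<subseteq> E" using F' by blast
  qed
  then have "good G" if "G \<in> support" for G using that by (auto simp: support_def C_def)
  then show ?thesis using \<sigma> unfolding good_def by blast
qed auto

text \<open>By dimension \<open>U\<close> contains a nonzero point of \<open>span F\<close>. The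
  signs put it, up to a factor \<open>-1\<close>, on the same side of every facet of
  \<open>F\<close> as \<open>y\<close>, so it is interior to \<open>F\<close>.\<close>

lemma stabbed_eq_if_sgn_pattern:
  assumes U: "subspace U" "dim U + Suc m = Suc DIM('a)" "U = {x. \<forall>j<m. B j \<bullet> x = 0}"
    and ne: "stabbed (Suc m) V \<noteq> {}"
    and \<sigma>: "\<sigma> \<in> {1, -1}" "\<forall>G\<in>support. sgn (pair_det m (M G) B) = \<sigma> * sgn (pair_det m (M G) A)"
  shows "stabbed (Suc m) U = stabbed (Suc m) V"
proof
  let ?S = "stabbed (Suc m) V"
  let ?A = "\<lambda>G. pair_det m (M G) A" and ?B = "\<lambda>G. pair_det m (M G) B"
  show sub: "?S \<subseteq> stabbed (Suc m) U"
  proof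
    fix F assume F: "F \<in> ?S"
    then have c: "cface F" "dim F = Suc m" by (auto simp: stabbed_def)
    obtain y where y: "y \<in> V" "y \<in> rel_interior F" "y \<noteq> 0" and line: "V \<inter> span F = span {y}"
      by (rule stabbed_line[OF V dim_V subset_refl F])
    have yF: "y \<in> F" using y(2) rel_interior_subset by blast
    have ni: "y \<notin> G" if "cface G" "G \<subseteq> F" "dim G = m" for G
      using rel_interior_not_in_facet[OF c(1) that(1,2)] that(3) c(2) y by auto
    have nzA: "?A G \<noteq> 0" if "cface G" "G \<subseteq> F" "dim G = m" for G
      by (rule pair_det_M_nonzero[OF c(1) that yF ni[OF that]]) (use line V_eq in simp)
    have sB: "sgn (?B G) = \<sigma> * sgn (?A G)" if "cface G" "G \<subseteq> F" "dim G = m" for G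
      using \<sigma>(2) that F by (auto simp: support_def)
    obtain G0 where G0: "cface G0" "G0 \<subseteq> F" "dim G0 = m" by (rule cface_has_facet[OF c])
    have "1 \<le> dim (U \<inter> span F)" using dim_Int_ge[OF U(1) subspace_span, of F] U(2) c(2) by simp
    then have "\<not> U \<inter> span F \<subseteq> {0}" by (metis dim_eq_0 not_one_le_zero)
    then obtain x where x: "x \<in> U" "x \<in> span F" "x \<noteq> 0" by blast
    have co: "\<exists>s. v - s *\<^sub>R y \<in> span G
        \<and> (\<exists>b. (\<forall>x\<in>G. b \<bullet> x = 0) \<and> 0 < b \<bullet> y \<and> b \<bullet> v = s * (b \<bullet> y))"
      if G: "cface G" "G \<subseteq> F" "dim G = m" and v: "v \<in> span F" for G v
    proof -
      have "dim F = Suc (dim G)" using c(2) G(3) by simp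
      then show ?thesis
        by (rule facet_coordinate[OF c(1) G(1,2) _ yF ni[OF G] v]) blast
    qed
    obtain r where r: "x - r *\<^sub>R y \<in> span G0" using co[OF G0 x(2)] by blast
    \<comment> \<open>Otherwise \<open>x\<close> would be a nonzero point of \<open>span G0\<close>
      killed by \<open>B\<close>, and the determinant at \<open>G0\<close> would vanish.\<close>
    have "r \<noteq> 0"
    proof
      assume "r = 0"
      then have "?B G0 = 0"
        using r x U(3) by (intro pair_det_eq_0[of x]) (auto simp: span_M[OF G0(1,3)])
      then show False using sB[OF G0] \<sigma>(1) nzA[OF G0] by (auto simp: sgn_zero_iff)
    qed
    \<comment> \<open>This choice of sign makes the coordinate modulo \<open>G0\<close> positive;
      the other facets have to follow.\<close>
    define z where "z = sgn r *\<^sub>R x"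
    have z: "z \<in> U" "z \<in> span F" "z \<noteq> 0"
      using x U(1) \<open>r \<noteq> 0\<close> by (auto simp: z_def subspace_scale span_scale sgn_zero_iff)
    have "z - \<bar>r\<bar> *\<^sub>R y = sgn r *\<^sub>R (x - r *\<^sub>R y)"
      by (simp add: z_def algebra_simps abs_sgn)
    then have zr: "z - \<bar>r\<bar> *\<^sub>R y \<in> span G0" using r span_scale by metis
    have "z \<in> rel_interior F"
    proof (rule rel_interior_cfaceI[OF c(1) y(2) z(2)])
      fix G assume G': "cface G" "G \<subseteq> F" "dim F = Suc (dim G)"
      then have G: "cface G" "G \<subseteq> F" "dim G = m" using c(2) by auto
      obtain s b where s: "z - s *\<^sub>R y \<in> span G"
        and b: "\<forall>x\<in>G. b \<bullet> x = 0" "0 < b \<bullet> y" "b \<bullet> z = s * (b \<bullet> y)"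
        using co[OF G z(2)] by blast
      \<comment> \<open>The sign \<open>\<sigma>\<close> enters both sides once and cancels, so
        \<open>s\<close> has the sign of \<open>\<bar>r\<bar>\<close>.\<close>
      have "?A G * ?B G0 * s = ?A G0 * ?B G * \<bar>r\<bar>"
        by (rule pair_det_ratio_same_face[OF U(3) c G G0 y(1) yF y(3) z(1,3) s zr])
      then have "sgn (?A G * ?B G0 * s) = sgn (?A G0 * ?B G * \<bar>r\<bar>)" by simp
      then have "sgn s = 1"
        using sB[OF G] sB[OF G0] nzA[OF G] nzA[OF G0] \<sigma>(1) \<open>r \<noteq> 0\<close>
        by (auto simp: sgn_mult sgn_zero_iff)
      then have "0 < s" by (simp add: sgn_1_pos)
      then show "\<exists>b. (\<forall>x\<in>G. b \<bullet> x = 0) \<and> 0 < b \<bullet> y \<and> 0 < b \<bullet> z"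
        using b by (intro exI[of _ b]) simp
    qed
    then show "F \<in> stabbed (Suc m) U" using c z by (auto simp: stabbed_def)
  qed
  show "stabbed (Suc m) U \<subseteq> ?S"
  \<comment> \<open>The faces stabbed by \<open>V\<close> are closed under neighbours and stabbed by
    \<open>U\<close>, so connectedness for \<open>U\<close> leaves no room for others.\<close>
  proof (rule stabbed_subset_if_closed[OF U(1,2) sub ne])
    fix F E assume "F \<in> ?S" "cface E" "F \<subseteq> E" "dim E = Suc (Suc m)"
    then show "\<exists>F'\<in>?S. F' \<noteq> F \<and> F' \<subseteq> E" by (rule stabbed_neighbour)
  qed
qed

end

section \<open>Translation between the polytope and its cone\<close>

theorem theorem3p1:
  fixes S :: "(real^('n::{finite,linorder})) set" and k :: nat
    and V W :: "(real^('n::{finite,linorder})) set"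
    and M :: "(real^('n::{finite,linorder})) set \<Rightarrow> nat \<Rightarrow> real^('n::{finite,linorder})"
    and AV AW :: "nat \<Rightarrow> real^('n::{finite,linorder})"
  assumes "is_polytope S"
    and "dim S = CARD('n)"
    and "1 \<le> k" and "k \<le> CARD('n)"
    and "V \<in> Pmax (polycone S) k"
    and "vertex_choice (polycone S) k M"
    and "kernel_matrix (CARD('n) - k) AV V"
    and "W \<in> Gr k"
    and "kernel_matrix (CARD('n) - k) AW W"
  shows "W \<in> stabbing_chamber (polycone S) k V \<longleftrightarrow>
         sign_equiv (chow_support (polycone S) k V)
           (\<lambda>G. chow_form (CARD('n) - k) (M G) AV)
           (\<lambda>G. chow_form (CARD('n) - k) (M G) AW)"
proof -
  define m where "m = CARD('n) - k"
  have mk: "int CARD('n) - int k = int m" "k + m = CARD('n)"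
    using assms(4) by (auto simp: m_def)
  obtain a where S: "finite S" "\<And>v. v \<in> S \<Longrightarrow> 0 < a \<bullet> v"
    using assms(1) by (auto simp: is_polytope_def)
  interpret full_pointed_polycone S a
    by standard (use S assms(2) in auto)
  have V: "subspace V" "dim V = k" and W: "subspace W" "dim W = k"
    using assms(5,8) by (auto simp: Pmax_def Pk_def Gr_def)
  have cface_iff: "F face_of K \<and> F \<noteq> {} \<and> aff_dim F = int d \<longleftrightarrow> cface F \<and> dim F = d" for F d
    using cface_aff_dim[of F] unfolding cface_def by (metis of_nat_eq_iff)
  have low: "low_faces K k = {G. cface G \<and> dim G = m}"
    by (simp add: low_faces_def mk cface_iff)
  \<comment> \<open>The empty face is excluded from \<open>top_faces\<close> by its affine
    dimension, which is -1.\<close>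
  have "F \<noteq> {}" if "aff_dim F = int m + 1" for F :: "(real^('n::{finite,linorder})) set"
    using that by auto
  then have top: "top_faces K k = {F. cface F \<and> dim F = Suc m}"
    unfolding top_faces_def mk using cface_iff[of _ "Suc m"] by (metis add.commute of_nat_Suc)
  interpret chow_cone S a V m M AV
  proof
    show "subspace V" by (fact V(1))
    show "dim V + Suc m = Suc DIM(real^('n::{finite,linorder}))" using V(2) mk by simp
    show "x = 0" if "cface G" "dim G < Suc m" "x \<in> V" "x \<in> G" for G x
    proof (rule ccontr)
      assume "x \<noteq> 0"
      then have "meets V G" using that by (auto simp: meets_def)
      moreover have "aff_dim G < int CARD('n) - int k + 1"
        using cface_aff_dim[OF that(1)] that(2) mk by simp
      ultimately show False using assms(5) that(1) by (auto simp: Pmax_def cface_def)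
    qed
    show "V = {x. \<forall>j<m. AV j \<bullet> x = 0}"
      using assms(7) by (simp add: kernel_matrix_def m_def)
    show "M G i \<in> G" if "cface G" "dim G = m" "i < m" for G i
      using assms(6) that low by (auto simp: vertex_choice_def m_def is_vertex_in_def)
    show "inj_on (M G) {..<m}" "independent (M G ` {..<m})" if "cface G" "dim G = m" for G
      using assms(6) that low by (auto simp: vertex_choice_def m_def)
  qed
  have dim_W: "dim W + Suc m = Suc DIM(real^('n::{finite,linorder}))" using W(2) mk by simp
  have W_eq: "W = {x. \<forall>j<m. AW j \<bullet> x = 0}"
    using assms(9) by (simp add: kernel_matrix_def m_def)
  have meets_iff: "meets U (rel_interior F) \<longleftrightarrow> F \<in> stabbed (Suc m) U" if "F \<in> top_faces K k" for U F
    using that top by (auto simp: meets_def stabbed_def)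
  have stab: "stab_faces K k U = stabbed (Suc m) U" for U
    using meets_iff top by (auto simp: stab_faces_def stabbed_def)
  have "W \<in> stabbing_chamber K k V \<longleftrightarrow> stabbed (Suc m) W = stabbed (Suc m) V"
    using meets_iff assms(8) top by (auto simp: stabbing_chamber_def) (auto simp: stabbed_def)
  moreover have "G face_of F \<longleftrightarrow> G \<subseteq> F" if "cface G" "F \<in> stabbed (Suc m) V" for G F
    using that cface_face_of[of G F] face_of_imp_subset[of G F] by (auto simp: stabbed_def)
  then have supp: "chow_support K k V = support"
    unfolding chow_support_def low stab support_def by blast
  let ?A = "\<lambda>G. pair_det m (M G) AV" and ?B = "\<lambda>G. pair_det m (M G) AW"
  have "sign_equiv (chow_support K k V) (\<lambda>G. chow_form m (M G) AV) (\<lambda>G. chow_form m (M G) AW)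
      \<longleftrightarrow> (\<exists>\<sigma>\<in>{1, -1}. \<forall>G\<in>support. sgn (?B G) = \<sigma> * sgn (?A G))"
    unfolding sign_equiv_def supp chow_form_eq_pair_det by (auto simp: minus_equation_iff)
  \<comment> \<open>The descent in \<open>stabbed_nonempty\<close> starts from the cone itself,
    which \<open>V\<close> meets.\<close>
  moreover have "stabbed (Suc m) V \<noteq> {}"
    using assms(5) stabbed_nonempty[OF cface_K] by (auto simp: Pmax_def Pk_def meets_def)
  ultimately show ?thesis
    using sgn_pattern_if_stabbed[OF W(1) dim_W W_eq] stabbed_eq_if_sgn_pattern[OF W(1) dim_W W_eq]
    unfolding m_def by blast
qed

end
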